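(* For each positive integer $m$, let $E_m=\{z\in\mathbb{C}: z^m\in[-2,2]\}$. Then for every $m$, $$\mathcal{W}_{mn,\infty}(E_m)=2\quad\text{for all } n\ge 1,$$ and $$\lim_{n\to\infty}\mathcal{W}_{n,\infty}(E_m)=2.$$ Moreover, $$\lim_{m\to\infty}\mathcal{W}_{2m-1,\infty}(E_m)=4.$$
   Context: For a compact set $E\subset\mathbb{C}$ with infinitely many points, $T_n^E$ denotes the $n$th Chebyshev polynomial of $E$, i.e. the unique monic polynomial of degree $n$ minimising the supremum norm $\|P\|_E=\max_{z\in E}|P(z)|$ among all monic polynomials $P$ of degree $n$ with complex coefficients. $\operatorname{Cap}(E)$ denotes the logarithmic capacity of $E$. The Widom factors are $\mathcal{W}_{n,\infty}(E)=\|T_n^E\|_E/\operatorname{Cap}(E)^n$. *)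

theory Defs
  imports
    "HOL-Probability.Probability"
    "HOL-Computational_Algebra.Computational_Algebra"
begin

section \<open>Logarithmic capacity\<close>

text \<open>
  The kernel \<open>log (1 / |z - w|)\<close>. The diagonal is treated separately because
  \<^term>\<open>ln (0::real) = 0\<close> in HOL, whereas the kernel is infinite there.
\<close>

definition log_kernel :: "complex \<Rightarrow> complex \<Rightarrow> ereal" where
  "log_kernel z w = (if z = w then \<infinity> else ereal (- ln (cmod (z - w))))"

text \<open>
  The logarithmic energy \<open>I(\<mu>)\<close>, the double integral of \<open>log (1 / |z - w|)\<close>, taken as the
  integral of the positive part minus the integral of the negative part;
  \<^const>\<open>e2ennreal\<close> sends negative values to 0. If \<open>\<mu>\<close> is a probability measure carried by
  a bounded set, the second integral is finite, so the difference is a well-defined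
  element of the extended reals that is greater than minus infinity.
\<close>

definition log_energy :: "complex measure \<Rightarrow> ereal" where
  "log_energy \<mu> =
     enn2ereal (\<integral>\<^sup>+ z. \<integral>\<^sup>+ w. e2ennreal (log_kernel z w) \<partial>\<mu> \<partial>\<mu>)
     - enn2ereal (\<integral>\<^sup>+ z. \<integral>\<^sup>+ w. e2ennreal (- log_kernel z w) \<partial>\<mu> \<partial>\<mu>)"

definition prob_measures_on :: "complex set \<Rightarrow> complex measure set" where
  "prob_measures_on E = {\<mu>. prob_space \<mu> \<and> sets \<mu> = sets borel \<and> emeasure \<mu> (- E) = 0}"

text \<open>
  The infimum of the energies is infinite exactly for the polar sets (including the empty
  set), whose capacity is 0. The definitions are meant for compact \<^term>\<open>E\<close>.
\<close>

definition robin_constant :: "complex set \<Rightarrow> ereal" where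
  "robin_constant E = (INF \<mu>\<in>prob_measures_on E. log_energy \<mu>)"

definition log_capacity :: "complex set \<Rightarrow> real" where
  "log_capacity E =
     (if robin_constant E = \<infinity> then 0 else exp (- real_of_ereal (robin_constant E)))"


section \<open>Chebyshev polynomials and Widom factors\<close>

definition sup_norm_on :: "complex set \<Rightarrow> complex poly \<Rightarrow> real" where
  "sup_norm_on E P = (SUP z\<in>E. cmod (poly P z))"

definition is_chebyshev_poly :: "complex set \<Rightarrow> nat \<Rightarrow> complex poly \<Rightarrow> bool" where
  "is_chebyshev_poly E n P \<longleftrightarrow>
     degree P = n \<and> lead_coeff P = 1 \<and>
     (\<forall>Q. degree Q = n \<longrightarrow> lead_coeff Q = 1 \<longrightarrow> sup_norm_on E P \<le> sup_norm_on E Q)"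

text \<open>Existence and uniqueness hold for compact sets with infinitely many points.\<close>

definition chebyshev_poly :: "complex set \<Rightarrow> nat \<Rightarrow> complex poly" where
  "chebyshev_poly E n = (THE P. is_chebyshev_poly E n P)"

definition widom_factor :: "nat \<Rightarrow> complex set \<Rightarrow> real" where
  "widom_factor n E = sup_norm_on E (chebyshev_poly E n) / log_capacity E ^ n"


section \<open>The star-shaped sets\<close>

definition star_set :: "nat \<Rightarrow> complex set" where
  "star_set m = {z. z ^ m \<in> complex_of_real ` {-2..2}}"

end

theory Submission
  imports Defs "HOL-Complex_Analysis.Complex_Analysis" "HOL-Real_Asymp.Real_Asymp"
begin

text \<open>
  The set \<open>E = star_set m\<close> has capacity 1. Its equilibrium measure is the image of the uniform
  distribution under the \<open>m\<close>-th roots of \<open>2 cos t\<close>, and its energy vanishes because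
  \<open>ln |1 - u|\<close> has mean 0 over the unit circle. Conversely no probability measure on \<open>E\<close> has
  negative energy, since \<open>E\<close> carries uniformly bounded monic polynomials of every degree and
  hence \<open>n\<close> points of \<open>E\<close> have a discriminant of size at most \<open>exp (O(n log n))\<close>.

  Averaging over rotations, a monic polynomial of degree \<open>m n + l\<close> with \<open>l < m\<close> may be replaced by
  \<open>z^l Q (z^m)\<close> with \<open>Q\<close> real and monic of degree \<open>n\<close>. This is a Chebyshev problem on \<open>[-2, 2]\<close> with
  weight \<open>|x| powr (l / m)\<close>. For \<open>x = 2 cos t\<close> and \<open>s = cis (2 t)\<close> the weight is \<open>|1 + s| powr (l / m)\<close>,
  which is compared with weights \<open>1 / |q s|\<close>, where \<open>q\<close> is a Taylor polynomial of a power
  of \<open>1 + r s\<close> with \<open>r < 1\<close> close to 1. For such weights the minimum is exactly 2 once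
  \<open>n\<close> is large, by the alternation argument of Bernstein and Szego. In degree \<open>2 m - 1\<close> one has
  \<open>n = 1\<close>, and comparing the values at \<open>x = 2\<close> and \<open>x = -2\<close> shows that \<open>Q x = x\<close> is optimal.
\<close>

section \<open>Lagrange interpolation\<close>

definition lagrange_basis :: "'a::field set \<Rightarrow> 'a \<Rightarrow> 'a poly" where
  "lagrange_basis A a = (\<Prod>b\<in>A - {a}. smult (1 / (a - b)) [:- b, 1:])"

lemma poly_lagrange_basis:
  assumes "finite A" "c \<in> A"
  shows "poly (lagrange_basis A a) c = (if c = a then 1 else 0)"
proof (cases "c = a")
  case True
  then show ?thesis
    by (auto simp: lagrange_basis_def poly_prod simp flip: diff_divide_distrib intro!: prod.neutral split: if_splits)
next
  case False
  with assms have "\<exists>b\<in>A - {a}. poly (smult (1 / (a - b)) [:- b, 1:]) c = 0"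
    by (intro bexI[of _ c]) auto
  then have "(\<Prod>b\<in>A - {a}. poly (smult (1 / (a - b)) [:- b, 1:]) c) = 0"
    using assms by (intro prod_zero) auto
  with False show ?thesis
    by (simp add: lagrange_basis_def poly_prod)
qed

lemma degree_lagrange_basis:
  assumes "finite A" "a \<in> A"
  shows "degree (lagrange_basis A a) = card A - 1"
proof -
  have "degree (lagrange_basis A a) = (\<Sum>b\<in>A - {a}. degree (smult (1 / (a - b)) [:- b, 1:]))"
    unfolding lagrange_basis_def by (rule degree_prod_eq_sum_degree) auto
  also have "\<dots> = (\<Sum>b\<in>A - {a}. 1)"
    by (intro sum.cong) auto
  finally show ?thesis
    using assms by simp
qed

lemma lead_coeff_lagrange_basis:
  assumes "finite A" "a \<in> A"
  shows "coeff (lagrange_basis A a) (card A - 1) = 1 / (\<Prod>b\<in>A - {a}. a - b)"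
proof -
  have "coeff (lagrange_basis A a) (card A - 1) = lead_coeff (lagrange_basis A a)"
    using assms by (simp add: degree_lagrange_basis)
  also have "\<dots> = 1 / (\<Prod>b\<in>A - {a}. a - b)"
    unfolding lagrange_basis_def lead_coeff_prod lead_coeff_smult
    by (simp add: prod_dividef)
  finally show ?thesis .
qed

lemma degree_lagrange_sum_less:
  assumes "finite A" "A \<noteq> {}"
  shows "degree (\<Sum>a\<in>A. smult (v a) (lagrange_basis A a)) < card A"
proof -
  have "degree (\<Sum>a\<in>A. smult (v a) (lagrange_basis A a)) \<le> card A - 1"
    using assms by (intro degree_sum_le) (auto simp: degree_lagrange_basis)
  also have "\<dots> < card A"
    using assms by (simp add: card_gt_0_iff)
  finally show ?thesis .
qed

lemma poly_lagrange_sum: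
  assumes "finite A" "c \<in> A"
  shows "poly (\<Sum>a\<in>A. smult (v a) (lagrange_basis A a)) c = v c"
proof -
  have "poly (\<Sum>a\<in>A. smult (v a) (lagrange_basis A a)) c = (\<Sum>a\<in>A. if c = a then v a else 0)"
    using assms unfolding poly_sum by (intro sum.cong) (auto simp: poly_lagrange_basis)
  then show ?thesis
    using assms by simp
qed

lemma lagrange_interpolation:
  fixes p :: "'a::field poly"
  assumes "finite A" "degree p < card A"
  shows "p = (\<Sum>a\<in>A. smult (poly p a) (lagrange_basis A a))"
proof (rule poly_eqI_degree[of A])
  show "degree (\<Sum>a\<in>A. smult (poly p a) (lagrange_basis A a)) < card A"
    using assms by (intro degree_lagrange_sum_less) auto
qed (use assms in \<open>auto simp: poly_lagrange_sum\<close>)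

text \<open>Comparison of the coefficients of degree \<open>card A - 1\<close> in the interpolation
  formula; the right side is a divided difference. For a monic \<open>p\<close> of exactly that
  degree the sum equals 1, which drives the discriminant estimate.\<close>

lemma lagrange_lead_coeff:
  fixes p :: "'a::field poly"
  assumes "finite A" "degree p < card A"
  shows "coeff p (card A - 1) = (\<Sum>a\<in>A. poly p a / (\<Prod>b\<in>A - {a}. a - b))"
  using assms(1) by (subst lagrange_interpolation[OF assms], subst coeff_sum)
     (intro sum.cong, auto simp: lead_coeff_lagrange_basis[simplified])

section \<open>Existence and uniqueness of Chebyshev polynomials\<close>

text \<open>Bolzano-Weierstrass, refining the subsequence once for each element of \<open>A\<close>.
  Applied to the values of polynomials at finitely many nodes it supplies the compactness behind the
  existence of minimisers.\<close>

lemma bounded_family_convergent_subseq: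
  fixes f :: "nat \<Rightarrow> 'b \<Rightarrow> complex"
  assumes "finite A" "\<And>a k. a \<in> A \<Longrightarrow> cmod (f k a) \<le> B"
  shows "\<exists>r. strict_mono r \<and> (\<forall>a\<in>A. convergent (\<lambda>k. f (r k) a))"
  using assms
proof (induction A)
  case empty
  show ?case
    by (rule exI[of _ id]) (auto simp: strict_mono_def)
next
  case (insert x A)
  then obtain r where r: "strict_mono r" "\<forall>a\<in>A. convergent (\<lambda>k. f (r k) a)"
    by auto
  have "bounded (range (\<lambda>k. f (r k) x))"
    using insert.prems by (auto simp: bounded_iff)
  then obtain l s where s: "strict_mono s" "((\<lambda>k. f (r k) x) \<circ> s) \<longlonglongrightarrow> l"
    using bounded_imp_convergent_subsequence by blast
  have "convergent (\<lambda>k. f (r (s k)) a)" if "a \<in> insert x A" for a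
  proof (cases "a = x")
    case True
    with s show ?thesis
      by (auto simp: convergent_def o_def)
  next
    case False
    with that r have "convergent (\<lambda>k. f (r k) a)"
      by auto
    from convergent_subseq_convergent[OF this s(1)] show ?thesis
      by (simp add: o_def)
  qed
  with r s show ?case
    by (intro exI[of _ "r \<circ> s"] conjI strict_mono_o) auto
qed

section \<open>Supremum norms of polynomials on compact sets\<close>

lemma bdd_above_poly_image:
  assumes "compact E"
  shows "bdd_above ((\<lambda>z. cmod (poly P z)) ` E)"
proof -
  have "compact ((\<lambda>z. cmod (poly P z)) ` E)"
    using assms by (intro compact_continuous_image continuous_intros)
  then show ?thesis
    by (intro bounded_imp_bdd_above compact_imp_bounded)
qed

lemma cmod_poly_le_sup_norm_on:
  assumes "compact E" "z \<in> E"
  shows "cmod (poly P z) \<le> sup_norm_on E P"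
  unfolding sup_norm_on_def using assms by (intro cSUP_upper bdd_above_poly_image)

lemma sup_norm_on_le:
  assumes "E \<noteq> {}" "\<And>z. z \<in> E \<Longrightarrow> cmod (poly P z) \<le> B"
  shows "sup_norm_on E P \<le> B"
  unfolding sup_norm_on_def using assms by (intro cSUP_least)

lemma sup_norm_on_attained:
  assumes "compact E" "E \<noteq> {}"
  obtains z where "z \<in> E" "cmod (poly P z) = sup_norm_on E P"
proof -
  obtain z where z: "z \<in> E" "\<And>y. y \<in> E \<Longrightarrow> cmod (poly P y) \<le> cmod (poly P z)"
    using continuous_attains_sup[OF assms continuous_on_norm[OF continuous_on_poly[OF continuous_on_id]], of P]
    by blast
  then have "sup_norm_on E P = cmod (poly P z)"
    using assms by (intro antisym sup_norm_on_le cmod_poly_le_sup_norm_on) auto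
  with z that show ?thesis
    by metis
qed

lemma sup_norm_on_nonneg:
  assumes "compact E" "E \<noteq> {}"
  shows "sup_norm_on E P \<ge> 0"
  using sup_norm_on_attained[OF assms, of P] norm_ge_zero by metis

text \<open>A minimising sequence is bounded at \<open>n + 1\<close> nodes in \<open>E\<close>, so
  its values there converge along a subsequence. Lagrange interpolation turns this into convergence
  of every coefficient, and the limit is monic of degree \<open>n\<close> with norm at most the
  infimum.\<close>

lemma is_chebyshev_poly_exists:
  assumes "compact E" "infinite E"
  shows "\<exists>P. is_chebyshev_poly E n P"
proof -
  have ne: "E \<noteq> {}"
    using assms by auto
  define S where "S = {P :: complex poly. degree P = n \<and> lead_coeff P = 1}"
  define L where "L = Inf (sup_norm_on E ` S)"
  have "monom 1 n \<in> S"
    by (simp add: S_def degree_monom_eq)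
  then have S: "sup_norm_on E ` S \<noteq> {}"
    by auto
  have bdd: "bdd_below (sup_norm_on E ` S)"
    using sup_norm_on_nonneg[OF assms(1) ne] by (intro bdd_belowI) auto
  have "\<exists>P\<in>S. sup_norm_on E P < L + 1 / real (Suc k)" for k
    using cInf_lessD[OF S, of "L + 1 / real (Suc k)"] by (auto simp: L_def)
  then obtain f where f: "\<And>k. f k \<in> S" "\<And>k. sup_norm_on E (f k) < L + 1 / real (Suc k)"
    by metis
  obtain A where A: "finite A" "card A = Suc n" "A \<subseteq> E"
    using infinite_arbitrarily_large[OF assms(2)] by metis
  have "cmod (poly (f k) a) \<le> L + 1" if "a \<in> A" for a k
  proof -
    have "cmod (poly (f k) a) \<le> sup_norm_on E (f k)"
      using that A assms by (intro cmod_poly_le_sup_norm_on) auto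
    also have "\<dots> \<le> L + 1 / real (Suc k)"
      using f(2)[of k] by simp
    also have "\<dots> \<le> L + 1"
      by (simp add: field_simps)
    finally show ?thesis .
  qed
  from bounded_family_convergent_subseq[OF A(1), where f = "\<lambda>k. poly (f k)", OF this]
  obtain r where r: "strict_mono r" "\<forall>a\<in>A. convergent (\<lambda>k. poly (f (r k)) a)"
    by auto
  then obtain v where v: "\<And>a. a \<in> A \<Longrightarrow> (\<lambda>k. poly (f (r k)) a) \<longlonglongrightarrow> v a"
    unfolding convergent_def by metis
  define P where "P = (\<Sum>a\<in>A. smult (v a) (lagrange_basis A a))"
  have f_eq: "f k = (\<Sum>a\<in>A. smult (poly (f k) a) (lagrange_basis A a))" for k
    using f(1)[of k] A by (intro lagrange_interpolation) (auto simp: S_def)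
  have coeff_lim: "(\<lambda>k. coeff (f (r k)) i) \<longlonglongrightarrow> coeff P i" for i
  proof -
    have "(\<lambda>k. \<Sum>a\<in>A. poly (f (r k)) a * coeff (lagrange_basis A a) i) \<longlonglongrightarrow>
            (\<Sum>a\<in>A. v a * coeff (lagrange_basis A a) i)"
      by (intro tendsto_intros v)
    then show ?thesis
      by (subst f_eq) (simp add: P_def coeff_sum)
  qed
  have poly_lim: "(\<lambda>k. poly (f (r k)) z) \<longlonglongrightarrow> poly P z" for z
  proof -
    have "(\<lambda>k. \<Sum>a\<in>A. poly (f (r k)) a * poly (lagrange_basis A a) z) \<longlonglongrightarrow>
            (\<Sum>a\<in>A. v a * poly (lagrange_basis A a) z)"
      by (intro tendsto_intros v)
    then show ?thesis
      by (subst f_eq) (simp add: P_def poly_sum)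
  qed
  have deg: "degree P \<le> n"
    unfolding P_def using A by (intro degree_sum_le) (auto simp: degree_lagrange_basis)
  have "(\<lambda>k. coeff (f (r k)) n) = (\<lambda>k. 1)"
    using f(1) unfolding S_def by (metis (mono_tags, lifting) mem_Collect_eq)
  with coeff_lim[of n] have one: "coeff P n = 1"
    by (simp add: LIMSEQ_const_iff)
  with deg have "degree P = n"
    by (simp add: le_antisym le_degree)
  with one have "P \<in> S"
    by (simp add: S_def)
  have "cmod (poly P z) \<le> L" if "z \<in> E" for z
  proof (rule LIMSEQ_le[OF tendsto_norm[OF poly_lim]])
    have "(\<lambda>k. L + 1 / real (Suc k)) \<longlonglongrightarrow> L + 0"
      using LIMSEQ_inverse_real_of_nat by (intro tendsto_intros) (simp add: inverse_eq_divide)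
    from LIMSEQ_subseq_LIMSEQ[OF this r(1)]
    show "(\<lambda>k. L + 1 / real (Suc (r k))) \<longlonglongrightarrow> L"
      by (simp add: o_def)
    show "\<exists>N. \<forall>k\<ge>N. cmod (poly (f (r k)) z) \<le> L + 1 / real (Suc (r k))"
      using f(2) cmod_poly_le_sup_norm_on[OF assms(1) that]
      by (meson less_eq_real_def order_trans)
  qed
  then have PL: "sup_norm_on E P \<le> L"
    using ne by (intro sup_norm_on_le)
  have "L \<le> sup_norm_on E Q" if "Q \<in> S" for Q
    unfolding L_def using that bdd by (intro cInf_lower) auto
  with PL \<open>P \<in> S\<close> show ?thesis
    unfolding is_chebyshev_poly_def S_def by (intro exI[of _ P]) force
qed

text \<open>A perturbation argument in the style of Kolmogorov. With at most \<open>n\<close>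
  extremal points, some \<open>h\<close> of degree below \<open>n\<close> interpolates
  \<open>P\<close> on all of them, and \<open>P - t h\<close> stays monic. By minimality its norm is
  still at least \<open>L\<close>; its maximum points accumulate, as \<open>t\<close> tends to 0, at
  an extremal point of \<open>P\<close>, where moving against \<open>h = P\<close> must decrease the
  modulus.\<close>

lemma is_chebyshev_poly_extremal_points:
  assumes "compact E" "infinite E" "is_chebyshev_poly E n P"
  defines "Z \<equiv> {z \<in> E. cmod (poly P z) = sup_norm_on E P}"
  assumes "finite Z"
  shows "card Z > n"
proof (rule ccontr)
  assume "\<not> card Z > n"
  then have card: "card Z \<le> n"
    by simp
  have ne: "E \<noteq> {}"
    using assms by auto
  define L where "L = sup_norm_on E P"
  obtain z0 where z0: "z0 \<in> Z"
    using sup_norm_on_attained[OF assms(1) ne, of P] by (auto simp: Z_def)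
  have P: "degree P = n" "lead_coeff P = 1"
    and min: "\<And>Q. degree Q = n \<Longrightarrow> lead_coeff Q = 1 \<Longrightarrow> L \<le> sup_norm_on E Q"
    using assms(3) by (auto simp: is_chebyshev_poly_def L_def)
  have "L > 0"
  proof (rule ccontr)
    assume "\<not> L > 0"
    then have "cmod (poly P z) \<le> 0" if "z \<in> E" for z
      using cmod_poly_le_sup_norm_on[OF assms(1) that, of P] by (fold L_def) linarith
    then have "E \<subseteq> {z. poly P z = 0}"
      by (simp add: subset_iff)
    moreover have "P \<noteq> 0"
      using P by auto
    ultimately show False
      using poly_roots_finite finite_subset assms(2) by blast
  qed
  define h where "h = (\<Sum>a\<in>Z. smult (poly P a) (lagrange_basis Z a))"
  have "degree h < card Z"
    unfolding h_def using assms(5) z0 by (intro degree_lagrange_sum_less) auto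
  with card have degh: "degree h < n"
    by simp
  have h: "poly h z = poly P z" if "z \<in> Z" for z
    unfolding h_def using poly_lagrange_sum[OF assms(5) that, of "poly P"] .
  define t where "t k = 1 / real (Suc k)" for k
  have t_pos: "t k > 0" for k
    by (simp add: t_def)
  have t_lim: "t \<longlonglongrightarrow> 0"
    unfolding t_def using LIMSEQ_inverse_real_of_nat by (simp add: inverse_eq_divide)
  define Q where "Q k = P - smult (of_real (t k)) h" for k
  have degQ: "degree (Q k) = n" "lead_coeff (Q k) = 1" for k
  proof -
    have "degree (- smult (of_real (t k)) h) < degree P"
      using degh P t_pos[of k] by simp
    from degree_add_eq_left[OF this] lead_coeff_add_le[OF this]
    show "degree (Q k) = n" "lead_coeff (Q k) = 1"
      using P by (simp_all add: Q_def add.commute)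
  qed
  have "\<exists>z\<in>E. L \<le> cmod (poly (Q k) z)" for k
    using sup_norm_on_attained[OF assms(1) ne, of "Q k"] min[OF degQ] by metis
  then obtain z where z: "\<And>k. z k \<in> E" "\<And>k. L \<le> cmod (poly (Q k) (z k))"
    by metis
  obtain l r where l: "l \<in> E" "strict_mono r" "(z \<circ> r) \<longlonglongrightarrow> l"
    using assms(1) z(1) unfolding compact_def by metis
  define w where "w = z \<circ> r"
  define s where "s = t \<circ> r"
  have w: "w \<longlonglongrightarrow> l" "\<And>k. w k \<in> E"
    using l z by (auto simp: w_def)
  have s: "s \<longlonglongrightarrow> 0" "\<And>k. s k > 0"
    using LIMSEQ_subseq_LIMSEQ[OF t_lim l(2)] t_pos by (auto simp: s_def)
  have bound: "L \<le> cmod (poly P (w k) - of_real (s k) * poly h (w k))" for k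
    using z(2)[of "r k"] by (simp add: Q_def w_def s_def)
  have polylim: "(\<lambda>k. poly p (w k)) \<longlonglongrightarrow> poly p l" for p
    using w(1) by (intro tendsto_poly)
  have "(\<lambda>k. cmod (poly P (w k) - of_real (s k) * poly h (w k))) \<longlonglongrightarrow> cmod (poly P l - of_real 0 * poly h l)"
    by (intro tendsto_intros polylim s)
  with bound have "L \<le> cmod (poly P l)"
    by (intro LIMSEQ_le_const) auto
  with l(1) cmod_poly_le_sup_norm_on[OF assms(1) l(1), of P] have "l \<in> Z"
    by (auto simp: Z_def L_def)
  \<comment> \<open>The square of \<open>cmod (P - s h)\<close> is expanded,
    \<open>cmod P \<le> L\<close> is inserted and one factor \<open>s k > 0\<close> is cancelled. In
    the limit the inner product at \<open>l\<close> is at most 0, whereas \<open>h = P\<close> at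
    \<open>l\<close> makes it \<open>L\<^sup>2\<close>.\<close>
  have "2 * (poly P (w k) \<bullet> poly h (w k)) \<le> s k * (cmod (poly h (w k)))\<^sup>2" for k
  proof -
    have "L\<^sup>2 \<le> (cmod (poly P (w k) - s k *\<^sub>R poly h (w k)))\<^sup>2"
      using bound[of k] \<open>L > 0\<close> by (intro power_mono) (auto simp: scaleR_conv_of_real)
    also have "\<dots> = (cmod (poly P (w k)))\<^sup>2 - 2 * s k * (poly P (w k) \<bullet> poly h (w k)) + (s k)\<^sup>2 * (cmod (poly h (w k)))\<^sup>2"
      unfolding power2_norm_eq_inner
      by (simp add: inner_diff_left inner_diff_right inner_commute power2_eq_square algebra_simps)
    also have "(cmod (poly P (w k)))\<^sup>2 \<le> L\<^sup>2"
      using cmod_poly_le_sup_norm_on[OF assms(1) w(2), of P] by (intro power_mono) (auto simp: L_def)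
    finally have "s k * (2 * (poly P (w k) \<bullet> poly h (w k))) \<le> s k * (s k * (cmod (poly h (w k)))\<^sup>2)"
      by (simp add: power2_eq_square)
    with s(2)[of k] show ?thesis
      by simp
  qed
  moreover have lim1: "(\<lambda>k. 2 * (poly P (w k) \<bullet> poly h (w k))) \<longlonglongrightarrow> 2 * (poly P l \<bullet> poly h l)"
    by (intro tendsto_intros polylim)
  moreover have lim2: "(\<lambda>k. s k * (cmod (poly h (w k)))\<^sup>2) \<longlonglongrightarrow> 0 * (cmod (poly h l))\<^sup>2"
    by (intro tendsto_intros polylim s)
  ultimately have "2 * (poly P l \<bullet> poly h l) \<le> 0 * (cmod (poly h l))\<^sup>2"
    by (intro LIMSEQ_le[OF lim1 lim2]) blast
  moreover have "poly P l \<bullet> poly h l = L\<^sup>2"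
    using h[OF \<open>l \<in> Z\<close>] \<open>l \<in> Z\<close> by (simp add: Z_def L_def power2_norm_eq_inner[symmetric])
  ultimately show False
    using \<open>L > 0\<close> by simp
qed

text \<open>Strict convexity of the ball, by the parallelogram law.\<close>

lemma eq_if_norm_le_mean:
  fixes a b :: "'a::real_inner"
  assumes "norm a \<le> L" "norm b \<le> L" "norm (a + b) = 2 * L"
  shows "a = b"
proof -
  have L: "L \<ge> 0"
    using assms(1) norm_ge_zero order_trans by blast
  have "(norm (a - b))\<^sup>2 + (norm (a + b))\<^sup>2 = 2 * (norm a)\<^sup>2 + 2 * (norm b)\<^sup>2"
    by (simp add: power2_norm_eq_inner inner_simps inner_commute)
  moreover have "(norm a)\<^sup>2 \<le> L\<^sup>2" "(norm b)\<^sup>2 \<le> L\<^sup>2"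
    using assms L by (auto intro: power_mono)
  moreover have "(norm (a + b))\<^sup>2 = 4 * L\<^sup>2"
    by (simp add: assms(3) power_mult_distrib)
  ultimately have "(norm (a - b))\<^sup>2 \<le> 0"
    by linarith
  then show ?thesis
    by simp
qed

text \<open>The mean of two minimisers is again a minimiser. At its extremal points strict convexity
  forces the two to agree, and there are more than \<open>n\<close> such points.\<close>

lemma is_chebyshev_poly_unique:
  assumes "compact E" "infinite E" "is_chebyshev_poly E n P1" "is_chebyshev_poly E n P2"
  shows "P1 = P2"
proof -
  have ne: "E \<noteq> {}"
    using assms by auto
  define L where "L = sup_norm_on E P1"
  have P1: "degree P1 = n" "coeff P1 n = 1" and P2: "degree P2 = n" "coeff P2 n = 1"
    and min: "\<And>Q. degree Q = n \<Longrightarrow> lead_coeff Q = 1 \<Longrightarrow> L \<le> sup_norm_on E Q"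
    and L2: "sup_norm_on E P2 = L"
    using assms(3,4) by (auto simp: is_chebyshev_poly_def L_def intro: antisym)
  define P where "P = smult (1/2) (P1 + P2)"
  have coeffP: "coeff P n = 1"
    using P1 P2 by (simp add: P_def)
  have "degree P \<le> n"
    unfolding P_def using P1 P2 by (intro order_trans[OF degree_smult_le] degree_add_le) auto
  with coeffP have degP: "degree P = n"
    by (simp add: le_antisym le_degree)
  have bd: "cmod (poly P1 z) \<le> L" "cmod (poly P2 z) \<le> L" if "z \<in> E" for z
    using cmod_poly_le_sup_norm_on[OF assms(1) that] L2 L_def by metis+
  have "cmod (poly P z) \<le> L" if "z \<in> E" for z
  proof -
    have "cmod (poly P z) = cmod (poly P1 z + poly P2 z) / 2"
      by (simp add: P_def norm_mult flip: distrib_left)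
    also have "\<dots> \<le> (L + L) / 2"
      using bd[OF that] by (intro divide_right_mono norm_triangle_mono) auto
    finally show ?thesis
      by simp
  qed
  then have "sup_norm_on E P \<le> L"
    using ne by (intro sup_norm_on_le)
  then have NP: "sup_norm_on E P = L"
    using min[of P] degP coeffP by simp
  have cheb: "is_chebyshev_poly E n P"
    using min degP coeffP NP by (simp add: is_chebyshev_poly_def)
  define Z where "Z = {z \<in> E. cmod (poly P z) = sup_norm_on E P}"
  have eqZ: "poly P1 z = poly P2 z" if "z \<in> Z" for z
  proof (rule eq_if_norm_le_mean)
    show "cmod (poly P1 z) \<le> L" "cmod (poly P2 z) \<le> L"
      using bd that by (auto simp: Z_def)
    show "cmod (poly P1 z + poly P2 z) = 2 * L"
      using that NP by (simp add: Z_def P_def norm_mult flip: distrib_left)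
  qed
  have "\<exists>A. A \<subseteq> Z \<and> card A = Suc n"
  proof (cases "finite Z")
    case True
    then have "Suc n \<le> card Z"
      using is_chebyshev_poly_extremal_points[OF assms(1,2) cheb] by (simp add: Z_def)
    then show ?thesis
      using obtain_subset_with_card_n by metis
  next
    case False
    then show ?thesis
      using infinite_arbitrarily_large by metis
  qed
  then obtain A where "A \<subseteq> Z" "card A = Suc n"
    by auto
  then show ?thesis
    using eqZ P1 P2 by (intro poly_eqI_degree[of A]) auto
qed

lemma chebyshev_poly_is_chebyshev:
  assumes "compact E" "infinite E"
  shows "is_chebyshev_poly E n (chebyshev_poly E n)"
  unfolding chebyshev_poly_def
proof (rule theI')
  obtain P where "is_chebyshev_poly E n P"
    using is_chebyshev_poly_exists[OF assms] by blast
  then show "\<exists>!P. is_chebyshev_poly E n P"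
    using is_chebyshev_poly_unique[OF assms] by (intro ex1I[of _ P])
qed

section \<open>Weighted Chebyshev problems on an interval\<close>

text \<open>Chebyshev polynomials of the first kind rescaled to \<open>[-2, 2]\<close>, where they
  become monic from degree 1 on. The value 2 in degree 0 fits the recurrence and the formula
  \<open>2 * cos (n * t)\<close>, but is not monic.\<close>

fun dickson_poly :: "nat \<Rightarrow> real poly" where
  "dickson_poly 0 = [:2:]"
| "dickson_poly (Suc 0) = [:0, 1:]"
| "dickson_poly (Suc (Suc n)) = [:0, 1:] * dickson_poly (Suc n) - dickson_poly n"

lemma poly_dickson_poly: "poly (dickson_poly n) (2 * cos t) = 2 * cos (real n * t)"
proof (induction n rule: dickson_poly.induct)
  case (3 n)
  have *: "cos (real (Suc (Suc n)) * t) = 2 * cos (real (Suc n) * t) * cos t - cos (real n * t)"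
    using cos_add[of "real (Suc n) * t" t] cos_diff[of "real (Suc n) * t" t]
    by (simp add: algebra_simps)
  show ?case
    unfolding dickson_poly.simps poly_diff poly_mult 3 * by simp
qed auto

lemma degree_dickson_poly_le: "degree (dickson_poly n) \<le> n"
proof (induction n rule: dickson_poly.induct)
  case (3 n)
  have "degree ([:0, 1:] * dickson_poly (Suc n)) \<le> degree [:0, 1::real:] + degree (dickson_poly (Suc n))"
    by (rule degree_mult_le)
  with 3 show ?case
    by (auto intro!: degree_diff_le)
qed auto

lemma coeff_dickson_poly: "n > 0 \<Longrightarrow> coeff (dickson_poly n) n = 1"
proof (induction n rule: dickson_poly.induct)
  case (3 n)
  have "coeff (dickson_poly n) (Suc (Suc n)) = 0"
    using degree_dickson_poly_le[of n] by (intro coeff_eq_0) auto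
  with 3 show ?case
    by (simp add: coeff_pCons)
qed auto

text \<open>In the variable \<open>x = 2 cos t\<close> this is twice the real part of
  \<open>cis (N t)\<close> times the conjugate of \<open>q (cis (2 t))\<close>. The argument
  \<open>cis (2 t)\<close> is the reason for steps of 2 in the index. The lemmas below assume
  \<open>2 * degree q < N\<close>, so the natural subtraction never truncates.\<close>

definition bernstein_szego_poly :: "nat \<Rightarrow> real poly \<Rightarrow> real poly" where
  "bernstein_szego_poly N q = (\<Sum>k\<le>degree q. smult (coeff q k) (dickson_poly (N - 2 * k)))"

lemma poly_bernstein_szego_poly:
  assumes "2 * degree q < N"
  shows "poly (bernstein_szego_poly N q) (2 * cos t) =
           2 * Re (cis (real N * t) * cnj (poly (map_poly of_real q) (cis (2 * t))))"
proof -
  have "Re (cis (real N * t) * cnj (poly (map_poly of_real q) (cis (2 * t)))) =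
          (\<Sum>k\<le>degree q. Re (cis (real N * t) * cnj (of_real (coeff q k) * cis (2 * t) ^ k)))"
    by (simp add: poly_altdef coeff_map_poly degree_map_poly sum_distrib_left del: times_complex.sel)
  also have "\<dots> = (\<Sum>k\<le>degree q. coeff q k * cos (real (N - 2 * k) * t))"
  proof (intro sum.cong refl)
    fix k assume "k \<in> {..degree q}"
    with assms have k: "2 * k \<le> N"
      by auto
    have "cis (real N * t) * cnj (of_real (coeff q k) * cis (2 * t) ^ k) =
            of_real (coeff q k) * (cis (real N * t) * cis (- (real k * (2 * t))))"
      by (simp add: Complex.DeMoivre cis_cnj del: times_complex.sel)
    also have "cis (real N * t) * cis (- (real k * (2 * t))) = cis (real (N - 2 * k) * t)"
      using k by (simp add: cis_mult of_nat_diff algebra_simps)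
    finally show "Re (cis (real N * t) * cnj (of_real (coeff q k) * cis (2 * t) ^ k)) =
                    coeff q k * cos (real (N - 2 * k) * t)"
      by (metis Re_complex_of_real cis.sel(1) scaleR_complex.sel(1) scaleR_conv_of_real real_scaleR_def)
  qed
  finally show ?thesis
    unfolding bernstein_szego_poly_def poly_sum poly_smult poly_dickson_poly
    by (simp add: sum_distrib_left mult_ac del: times_complex.sel)
qed

lemma bernstein_szego_poly_monic:
  assumes "coeff q 0 = 1" "2 * degree q < N"
  shows "degree (bernstein_szego_poly N q) = N" "coeff (bernstein_szego_poly N q) N = 1"
proof -
  have "coeff (dickson_poly (N - 2 * k)) N = (if k = 0 then 1 else 0)" if "k \<le> degree q" for k
    using that assms coeff_dickson_poly[of N] degree_dickson_poly_le[of "N - 2 * k"]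
    by (auto intro!: coeff_eq_0)
  then have "coeff (bernstein_szego_poly N q) N = (\<Sum>k\<le>degree q. if k = 0 then coeff q k else 0)"
    unfolding bernstein_szego_poly_def coeff_sum by (intro sum.cong) auto
  then show one: "coeff (bernstein_szego_poly N q) N = 1"
    using assms by (simp add: sum.delta)
  have "degree (bernstein_szego_poly N q) \<le> N"
    unfolding bernstein_szego_poly_def
    by (intro degree_sum_le)
       (auto intro!: order_trans[OF degree_smult_le] order_trans[OF degree_dickson_poly_le])
  with one show "degree (bernstein_szego_poly N q) = N"
    by (simp add: le_antisym le_degree)
qed

lemma abs_poly_bernstein_szego_poly_le:
  assumes "2 * degree q < N"
  shows "\<bar>poly (bernstein_szego_poly N q) (2 * cos t)\<bar> \<le> 2 * cmod (poly (map_poly of_real q) (cis (2 * t)))"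
proof -
  have "\<bar>Re (cis (real N * t) * cnj (poly (map_poly of_real q) (cis (2 * t))))\<bar>
          \<le> cmod (cis (real N * t) * cnj (poly (map_poly of_real q) (cis (2 * t))))"
    by (rule abs_Re_le_cmod)
  then show ?thesis
    unfolding poly_bernstein_szego_poly[OF assms] by (simp add: norm_mult)
qed

section \<open>Alternation and the Bernstein-Szego lower bound\<close>

lemma continuous_successive_values:
  fixes f :: "real \<Rightarrow> real"
  assumes "continuous_on {a..b} f" "a \<le> b" "f a = 0" "f b = real N * d" "d > 0"
  shows "\<exists>p. (\<forall>i\<le>N. a \<le> p i \<and> p i \<le> b \<and> f (p i) = real i * d) \<and> (\<forall>i<N. p i < p (Suc i))"
proof -
  have "\<exists>p. (\<forall>i\<le>n. a \<le> p i \<and> p i \<le> b \<and> f (p i) = real i * d) \<and> (\<forall>i<n. p i < p (Suc i))"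
    if "n \<le> N" for n
    using that
  proof (induction n)
    case 0
    show ?case
      by (rule exI[of _ "\<lambda>_. a"]) (use assms in auto)
  next
    case (Suc n)
    then obtain p where p: "\<forall>i\<le>n. a \<le> p i \<and> p i \<le> b \<and> f (p i) = real i * d" "\<forall>i<n. p i < p (Suc i)"
      by auto
    \<comment> \<open>The next value is sought to the right of the previous point, which makes the
      points increase although \<open>f\<close> may oscillate.\<close>
    have "\<exists>x\<ge>p n. x \<le> b \<and> f x = real (Suc n) * d"
    proof (rule IVT')
      show "f (p n) \<le> real (Suc n) * d"
        using p assms by (auto simp: algebra_simps)
      show "real (Suc n) * d \<le> f b"
        using Suc.prems assms by (auto intro!: mult_right_mono)
      show "p n \<le> b"
        using p by auto
      show "continuous_on {p n..b} f"
        by (rule continuous_on_subset[OF assms(1)]) (use p in auto)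
    qed
    then obtain x where x: "p n \<le> x" "x \<le> b" "f x = real (Suc n) * d"
      by auto
    have "p n \<noteq> x"
      using x p assms by auto
    with x p show ?case
      by (intro exI[of _ "p(Suc n := x)"]) (auto simp: le_Suc_eq less_Suc_eq intro: order_trans)
  qed
  then show ?thesis
    by blast
qed

text \<open>Each of the \<open>N\<close> gaps contains a zero by the intermediate value theorem. The
  strict sign condition excludes the endpoints, so zeros from different gaps are distinct.\<close>

lemma sign_changes_imp_zeros:
  fixes g :: "real \<Rightarrow> real"
  assumes "continuous_on {p 0..p N} g"
  assumes "\<And>i. i < N \<Longrightarrow> p i < p (Suc i)" "\<And>i. i < N \<Longrightarrow> g (p i) * g (p (Suc i)) < 0"
  shows "\<exists>X. X \<subseteq> {p 0..p N} \<and> card X = N \<and> (\<forall>x\<in>X. g x = 0)"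
proof -
  have mono: "p i \<le> p j" if "i \<le> j" "j \<le> N" for i j
    using that
  proof (induction rule: dec_induct)
    case (step n)
    then show ?case
      using assms(2)[of n] by auto
  qed auto
  have "\<exists>x>p i. x < p (Suc i) \<and> g x = 0" if i: "i < N" for i
  proof -
    have cont: "continuous_on {p i..p (Suc i)} g"
      by (rule continuous_on_subset[OF assms(1)]) (use i mono[of 0 i] mono[of "Suc i" N] in auto)
    have "\<exists>x\<ge>p i. x \<le> p (Suc i) \<and> g x = 0"
    proof (cases "g (p i) \<le> 0")
      case True
      with assms(3)[OF i] have "0 \<le> g (p (Suc i))"
        by (auto simp: mult_less_0_iff)
      with True show ?thesis
        using assms(2)[OF i] cont by (intro IVT') auto
    next
      case False
      with assms(3)[OF i] have "g (p (Suc i)) \<le> 0"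
        by (auto simp: mult_less_0_iff)
      with False show ?thesis
        using assms(2)[OF i] cont by (intro IVT2') auto
    qed
    then show ?thesis
      using assms(3)[OF i] by (metis less_eq_real_def mult_zero_left mult_zero_right order_less_irrefl)
  qed
  then obtain x where x: "\<And>i. i < N \<Longrightarrow> p i < x i \<and> x i < p (Suc i) \<and> g (x i) = 0"
    by metis
  have "x i < x j" if "i < j" "j < N" for i j
    using x[of i] x[of j] mono[of "Suc i" j] that by auto
  then have "inj_on x {..<N}"
    by (intro inj_onI) (metis lessThan_iff linorder_neqE_nat order_less_irrefl)
  then have "card (x ` {..<N}) = N"
    by (simp add: card_image)
  moreover have "x ` {..<N} \<subseteq> {p 0..p N}"
  proof safe
    fix i assume "i < N"
    then show "x i \<in> {p 0..p N}"
      using x[of i] mono[of 0 i] mono[of "Suc i" N] by auto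
  qed
  ultimately show ?thesis
    using x by (intro exI[of _ "x ` {..<N}"]) auto
qed

text \<open>Divided by the modulus of \<open>q\<close>, the Bernstein-Szego polynomial is
  \<open>2 * cos\<close> of a phase that runs from 0 to \<open>N * pi\<close>, so it takes the
  values 2 and -2 alternately at \<open>N + 1\<close> points. For \<open>M < 2\<close> its
  difference with \<open>R\<close> has the same alternating signs and thus \<open>N\<close> zeros.
  Both polynomials are monic of degree \<open>N\<close>, so the difference has degree below
  \<open>N\<close> or is 0; it vanishes, against the strict signs.\<close>

lemma bernstein_szego_lower_bound:
  fixes q R :: "real poly"
  assumes q: "coeff q 0 = 1" "2 * degree q < N"
  assumes pos: "\<And>s. cmod s = 1 \<Longrightarrow> Re (poly (map_poly of_real q) s) > 0"
  assumes R: "degree R = N" "coeff R N = 1"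
  assumes le: "\<And>t. \<bar>poly R (2 * cos t)\<bar> \<le> M * cmod (poly (map_poly of_real q) (cis (2 * t)))"
  shows "M \<ge> 2"
proof (rule ccontr)
  assume "\<not> M \<ge> 2"
  then have M: "M < 2"
    by simp
  define Q where "Q t = poly (map_poly complex_of_real q) (cis (2 * t))" for t
  \<comment> \<open>Positivity of \<open>Re (Q t)\<close> keeps \<open>Arg\<close> away from its
    branch cut, so the phase is continuous. As \<open>q\<close> is real, \<open>Q 0\<close> is a
    positive real; with \<open>Q pi = Q 0\<close> the phase starts at 0 and ends at
    \<open>N * pi\<close>.\<close>
  define \<theta> where "\<theta> t = real N * t - Arg (Q t)" for t
  have Qpos: "Re (Q t) > 0" for t
    using pos[of "cis (2 * t)"] by (simp add: Q_def)
  have Q0: "Arg (Q 0) = 0"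
  proof -
    have "Q 0 = of_real (poly q 1)"
      by (simp add: Q_def poly_altdef coeff_map_poly degree_map_poly)
    with Qpos[of 0] show ?thesis
      by (simp add: Arg_of_real)
  qed
  have Qpi: "Q pi = Q 0"
    by (simp add: Q_def)
  have contQ: "isCont Q t" for t
    unfolding Q_def cis_conv_exp by (intro continuous_intros)
  have "continuous_on {0..pi} \<theta>"
  proof (intro continuous_at_imp_continuous_on ballI)
    fix t :: real
    have "Q t \<notin> \<real>\<^sub>\<le>\<^sub>0"
      using Qpos[of t] by (auto elim!: nonpos_Reals_cases)
    from isCont_o2[OF contQ continuous_at_Arg[OF this]] show "isCont \<theta> t"
      unfolding \<theta>_def by (intro continuous_intros)
  qed
  from continuous_successive_values[OF this, of N pi] obtain p where
    p: "\<And>i. i \<le> N \<Longrightarrow> 0 \<le> p i \<and> p i \<le> pi \<and> \<theta> (p i) = real i * pi" "\<And>i. i < N \<Longrightarrow> p i < p (Suc i)"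
    by (auto simp: \<theta>_def Q0 Qpi)
  define D where "D = bernstein_szego_poly N q - R"
  have B: "poly (bernstein_szego_poly N q) (2 * cos t) = 2 * cmod (Q t) * cos (\<theta> t)" for t
  proof -
    have "cis (real N * t) * cnj (Q t) = cis (real N * t) * cnj (rcis (cmod (Q t)) (Arg (Q t)))"
      by (simp add: rcis_cmod_Arg)
    also have "\<dots> = rcis (cmod (Q t)) (\<theta> t)"
      by (simp add: rcis_def cis_cnj \<theta>_def cis_mult)
    finally show ?thesis
      unfolding poly_bernstein_szego_poly[OF q(2)] Q_def[symmetric] by simp
  qed
  have sgn: "(-1) ^ i * poly D (2 * cos (p i)) > 0" if "i \<le> N" for i
  proof -
    have 1: "(-1) ^ i * poly D (2 * cos (p i)) =
            (-1) ^ i * (2 * cmod (Q (p i)) * (-1) ^ i) - (-1) ^ i * poly R (2 * cos (p i))"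
      using p(1)[OF that] by (simp add: D_def B cos_npi algebra_simps)
    have 2: "(-1) ^ i * (2 * cmod (Q (p i)) * (-1) ^ i) = 2 * cmod (Q (p i))"
      by (simp flip: power_mult_distrib)
    have "(-1) ^ i * poly R (2 * cos (p i)) \<le> \<bar>(-1) ^ i * poly R (2 * cos (p i))\<bar>"
      by (rule abs_ge_self)
    also have "\<bar>(-1) ^ i * poly R (2 * cos (p i))\<bar> \<le> M * cmod (Q (p i))"
      using le[of "p i"] by (simp add: abs_mult power_abs Q_def)
    finally have "(2 - M) * cmod (Q (p i)) \<le> (-1) ^ i * poly D (2 * cos (p i))"
      unfolding 1 2 left_diff_distrib by linarith
    moreover have "Q (p i) \<noteq> 0"
      using Qpos[of "p i"] by auto
    then have "(2 - M) * cmod (Q (p i)) > 0"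
      using M by simp
    ultimately show ?thesis
      by linarith
  qed
  have "\<exists>X. X \<subseteq> {p 0..p N} \<and> card X = N \<and> (\<forall>x\<in>X. poly D (2 * cos x) = 0)"
  proof (rule sign_changes_imp_zeros)
    show "continuous_on {p 0..p N} (\<lambda>x. poly D (2 * cos x))"
      by (intro continuous_intros)
    fix i assume "i < N"
    with sgn[of i] sgn[of "Suc i"] p(2) show "p i < p (Suc i)"
      "poly D (2 * cos (p i)) * poly D (2 * cos (p (Suc i))) < 0"
      by (cases "even i"; auto simp: mult_less_0_iff)+
  qed
  then obtain X where X: "X \<subseteq> {p 0..p N}" "card X = N" "\<forall>x\<in>X. poly D (2 * cos x) = 0"
    by auto
  \<comment> \<open>The cosine is injective on \<open>[0, pi]\<close>, so distinct zeros in the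
    angle are distinct zeros of \<open>D\<close>.\<close>
  have "X \<subseteq> {0..pi}"
    using X(1) p(1)[of 0] p(1)[of N] by auto
  then have "inj_on (\<lambda>x. 2 * cos x) X"
    by (intro inj_onI) (auto intro!: cos_inj_pi)
  then have card: "card ((\<lambda>x. 2 * cos x) ` X) = N"
    using X(2) by (simp add: card_image)
  have "D = 0"
  proof (rule poly_eqI_degree_lead_coeff[of _ N])
    show "coeff D N = coeff 0 N"
      using bernstein_szego_poly_monic[OF q] R by (simp add: D_def)
    show "degree D \<le> N"
      using bernstein_szego_poly_monic[OF q] R unfolding D_def by (intro degree_diff_le) auto
    show "N \<le> card ((\<lambda>x. 2 * cos x) ` X)"
      using card by simp
  qed (use X in auto)
  with sgn[of 0] show False
    by simp
qed

section \<open>Power weights approximated by polynomials\<close>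

lemma binomial_poly_approx:
  fixes c r \<epsilon> :: real
  assumes "0 < r" "r < 1" "\<epsilon> > 0"
  shows "\<exists>q :: real poly. coeff q 0 = 1 \<and>
           (\<forall>s. cmod s \<le> 1 \<longrightarrow> cmod (poly (map_poly of_real q) s - (1 + of_real r * s) powr of_real c) \<le> \<epsilon>)"
proof -
  define a where "a k = (c gchoose k) * r ^ k" for k
  have a_complex: "complex_of_real (a k) = (of_real c gchoose k) * of_real r ^ k" for k
    by (simp add: a_def gbinomial_prod_rev)
  \<comment> \<open>The binomial series has radius of convergence at least 1, and
    \<open>r < 1\<close>. Absolute summability at \<open>r\<close> makes its partial sums converge
    uniformly for \<open>cmod s \<le> 1\<close>; \<open>q\<close> is such a partial sum.\<close>
  have "ereal (norm (complex_of_real r)) < conv_radius (\<lambda>n. complex_of_real c gchoose n)"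
    using assms by (simp add: conv_radius_gchoose)
  from abs_summable_in_conv_radius[OF this] have summ: "summable (\<lambda>k. \<bar>a k\<bar>)"
    unfolding a_complex[symmetric] by simp
  obtain N0 where N0: "\<And>n. n \<ge> N0 \<Longrightarrow> norm (\<Sum>k. \<bar>a (k + n)\<bar>) < \<epsilon>"
    using suminf_exist_split[OF assms(3) summ] by auto
  define N where "N = Suc N0"
  define q where "q = (\<Sum>k<N. monom (a k) k)"
  have coeffq: "coeff q k = (if k < N then a k else 0)" for k
    by (simp add: q_def coeff_sum if_distrib cong: if_cong)
  have polyq: "poly (map_poly of_real q) s = (\<Sum>k<N. of_real (a k) * s ^ k)" for s :: complex
  proof -
    have "map_poly complex_of_real q = (\<Sum>k<N. monom (of_real (a k)) k)"
      by (rule poly_eqI) (simp add: coeff_map_poly coeffq coeff_sum if_distrib cong: if_cong)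
    then show ?thesis
      by (simp add: poly_sum poly_monom)
  qed
  have "cmod (poly (map_poly of_real q) s - (1 + of_real r * s) powr of_real c) \<le> \<epsilon>" if s: "cmod s \<le> 1" for s
  proof -
    have "cmod (of_real r * s) \<le> r * 1"
      using assms s unfolding norm_mult by (intro mult_mono) auto
    then have "cmod (of_real r * s) < 1"
      using assms by simp
    from gen_binomial_complex[OF this, of "of_real c"]
    have sums: "(\<lambda>k. of_real (a k) * s ^ k) sums (1 + of_real r * s) powr of_real c"
      by (simp add: a_complex power_mult_distrib mult_ac)
    have le: "norm (of_real (a k) * s ^ k) \<le> \<bar>a k\<bar>" for k
      using s by (simp add: norm_mult norm_power mult_left_le power_le_one)
    have "(\<Sum>k. of_real (a k) * s ^ k) - (\<Sum>k<N. of_real (a k) * s ^ k) = (\<Sum>k. of_real (a (k + N)) * s ^ (k + N))"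
      using suminf_minus_initial_segment[OF sums_summable[OF sums], of N] by simp
    then have "cmod (poly (map_poly of_real q) s - (1 + of_real r * s) powr of_real c) =
                 norm (\<Sum>k. of_real (a (k + N)) * s ^ (k + N))"
      using sums_unique[OF sums] by (simp add: polyq norm_minus_commute)
    also have "\<dots> \<le> (\<Sum>k. \<bar>a (k + N)\<bar>)"
      using le summable_ignore_initial_segment[OF summ, of N] by (intro norm_suminf_le)
    also have "\<dots> \<le> \<epsilon>"
      using N0[of N] by (simp add: N_def)
    finally show ?thesis .
  qed
  moreover have "coeff q 0 = 1"
    by (simp add: coeffq N_def a_def)
  ultimately show ?thesis
    by blast
qed

text \<open>Replaces \<open>1 + s\<close>, which vanishes at \<open>s = -1\<close>, by the zero-free
  \<open>1 + r s\<close> on the unit circle, at the cost of the factor \<open>2 / (1 + r)\<close>,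
  which tends to 1 with \<open>r\<close>. The squares of the two sides differ by
  \<open>2 * (1 - r)\<^sup>2 * (1 - cos t)\<close>.\<close>

lemma one_plus_cis_le:
  fixes r :: real
  assumes "0 < r" "r < 1"
  shows "(1 + r) * cmod (1 + cis t) \<le> 2 * cmod (1 + of_real r * cis t)"
proof (rule power2_le_imp_le)
  have *: "(cmod (1 + of_real x * cis t))\<^sup>2 = 1 + x\<^sup>2 + 2 * x * cos t" for x :: real
  proof -
    have "(cmod (1 + of_real x * cis t))\<^sup>2 = (1 + x * cos t)\<^sup>2 + (x * sin t)\<^sup>2"
      by (simp add: cmod_power2)
    also have "\<dots> = 1 + (x\<^sup>2 * (cos t)\<^sup>2 + x\<^sup>2 * (sin t)\<^sup>2) + 2 * x * cos t"
      by (simp add: power2_sum power_mult_distrib)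
    finally show ?thesis
      by (simp flip: distrib_left)
  qed
  have "0 \<le> 2 * (1 - r)\<^sup>2 * (1 - cos t)"
    by simp
  also have "\<dots> = 4 * (1 + r\<^sup>2 + 2 * r * cos t) - (1 + r)\<^sup>2 * (2 + 2 * cos t)"
    by (simp add: power2_eq_square algebra_simps)
  finally show "((1 + r) * cmod (1 + cis t))\<^sup>2 \<le> (2 * cmod (1 + of_real r * cis t))\<^sup>2"
    using *[of r] *[of 1] by (simp add: power_mult_distrib)
qed simp

lemma abs_two_cos: "\<bar>2 * cos t\<bar> = cmod (1 + cis (2 * t))"
proof -
  have "1 + cis (2 * t) = cis t * of_real (2 * cos t)"
    by (simp add: complex_eq_iff cos_double_cos sin_double power2_eq_square)
  then have "cmod (1 + cis (2 * t)) = cmod (of_real (2 * cos t))"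
    by (simp only: norm_mult norm_cis mult_1)
  then show ?thesis
    by (simp only: norm_of_real)
qed

lemma two_cos_cases:
  assumes "x \<in> {-2..2::real}"
  obtains t where "x = 2 * cos t"
  using assms that[of "arccos (x / 2)"] by (auto simp: cos_arccos)

lemma cmod_powr_of_real:
  assumes "w \<noteq> 0"
  shows "cmod (w powr of_real c) = cmod w powr c"
  using assms by (simp add: powr_def)

text \<open>The exponent shrinks the argument, which lies within \<open>pi / 2\<close> of 0, and so
  increases its cosine. This keeps powers of \<open>1 + r s\<close>, and polynomials close to them,
  in the right half-plane, as the alternation argument demands.\<close>

lemma Re_powr_ge:
  assumes "Re w > 0" "0 < \<beta>" "\<beta> \<le> 1"
  shows "Re (w powr of_real \<beta>) \<ge> Re w * cmod w powr (\<beta> - 1)"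
proof -
  have w: "w \<noteq> 0"
    using assms(1) by auto
  have Arg: "\<bar>Arg w\<bar> < pi / 2"
    using assms(1) Arg_Re_pos by blast
  have "\<bar>\<beta> * Arg w\<bar> \<le> 1 * \<bar>Arg w\<bar>"
    unfolding abs_mult using assms by (intro mult_right_mono) auto
  then have "cos \<bar>Arg w\<bar> \<le> cos \<bar>\<beta> * Arg w\<bar>"
    using Arg by (intro cos_monotone_0_pi_le) auto
  then have cos: "cos (Arg w) \<le> cos (\<beta> * Arg w)"
    by simp
  have Re: "Re w = cmod w * cos (Arg w)"
    using rcis_cmod_Arg[of w] by (metis Re_rcis)
  have "Re w * cmod w powr (\<beta> - 1) = cmod w powr \<beta> * cos (Arg w)"
    using w by (subst Re) (simp add: powr_diff)
  also have "\<dots> \<le> cmod w powr \<beta> * cos (\<beta> * Arg w)"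
    using cos by (intro mult_left_mono) auto
  also have "\<dots> = Re (w powr of_real \<beta>)"
    using w by (simp add: powr_def Re_exp Arg_eq_Im_Ln)
  finally show ?thesis .
qed

text \<open>For \<open>q\<close> close to \<open>(1 + r s) powr (-\<gamma>)\<close> the
  Bernstein-Szego polynomial has modulus at most \<open>2 * cmod q\<close>. The weight nearly
  cancels \<open>cmod q\<close>, up to the factor
  \<open>(2 / (1 + r)) powr \<gamma>\<close>.\<close>

lemma weighted_monic_upper_bound:
  fixes \<gamma> \<epsilon> :: real
  assumes "0 \<le> \<gamma>" "\<gamma> \<le> 1" "\<epsilon> > 0"
  shows "\<forall>\<^sub>F n in sequentially. \<exists>Q :: real poly. degree Q = n \<and> coeff Q n = 1 \<and>
           (\<forall>x\<in>{-2..2}. \<bar>x\<bar> powr \<gamma> * \<bar>poly Q x\<bar> \<le> 2 + \<epsilon>)"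
proof -
  \<comment> \<open>Half of \<open>\<epsilon>\<close> pays for replacing \<open>1 + s\<close> by
    \<open>1 + r s\<close>. The other half pays for the approximation error
    \<open>\<epsilon> / 8\<close>, which is multiplied by 2 from the Bernstein-Szego bound and by a
    weight of at most 2.\<close>
  have "\<exists>r. 0 < r \<and> r < 1 \<and> 4 / (1 + r) \<le> 2 + \<epsilon> / 2"
    using assms(3) by (intro exI[of _ "1 / (1 + \<epsilon> / 4)"]) (auto simp: field_simps)
  then obtain r where r: "0 < r" "r < 1" "4 / (1 + r) \<le> 2 + \<epsilon> / 2"
    by auto
  obtain q :: "real poly" where q: "coeff q 0 = 1"
    "\<And>s. cmod s \<le> 1 \<Longrightarrow> cmod (poly (map_poly of_real q) s - (1 + of_real r * s) powr of_real (-\<gamma>)) \<le> \<epsilon> / 8"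
    using binomial_poly_approx[OF r(1,2), of "\<epsilon> / 8" "-\<gamma>"] assms(3) by auto
  show ?thesis
    using eventually_gt_at_top[of "2 * degree q"]
  proof eventually_elim
    case (elim N)
    have "\<bar>x\<bar> powr \<gamma> * \<bar>poly (bernstein_szego_poly N q) x\<bar> \<le> 2 + \<epsilon>" if "x \<in> {-2..2}" for x
    proof -
      from that obtain t where t: "x = 2 * cos t"
        by (rule two_cos_cases)
      define u where "u = cmod (1 + cis (2 * t))"
      define w where "w = 1 + of_real r * cis (2 * t)"
      have u: "\<bar>x\<bar> = u" "u \<le> 2"
        using abs_two_cos[of t] norm_triangle_ineq[of 1 "cis (2 * t)"] by (auto simp: t u_def)
      have "cmod (of_real r * cis (2 * t)) < 1"
        using r by (simp add: norm_mult)
      then have w: "w \<noteq> 0"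
        unfolding w_def by (metis add.commute add_eq_0_iff norm_minus_cancel norm_one order_less_irrefl)
      have uw: "u \<le> 2 / (1 + r) * cmod w"
        using one_plus_cis_le[OF r(1,2), of "2 * t"] r by (simp add: u_def w_def field_simps)
      have u0: "u \<ge> 0"
        by (simp add: u_def)
      have "cmod (poly (map_poly of_real q) (cis (2 * t))) \<le> cmod (w powr of_real (-\<gamma>)) + \<epsilon> / 8"
        using q(2)[of "cis (2 * t)"] norm_triangle_sub by (smt (verit) norm_cis w_def)
      also have "cmod (w powr of_real (-\<gamma>)) = cmod w powr (-\<gamma>)"
        using w by (rule cmod_powr_of_real)
      finally have Q: "cmod (poly (map_poly of_real q) (cis (2 * t))) \<le> cmod w powr (-\<gamma>) + \<epsilon> / 8" .
      have "u powr \<gamma> * cmod w powr (-\<gamma>) \<le> (2 / (1 + r) * cmod w) powr \<gamma> * cmod w powr (-\<gamma>)"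
        using uw u0 assms by (intro mult_right_mono powr_mono2) auto
      also have "\<dots> = (2 / (1 + r)) powr \<gamma> * (cmod w powr \<gamma> * cmod w powr (-\<gamma>))"
        using r by (subst powr_mult) auto
      also have "cmod w powr \<gamma> * cmod w powr (-\<gamma>) = 1"
        using w by (simp flip: powr_add)
      also have "(2 / (1 + r)) powr \<gamma> \<le> (2 / (1 + r)) powr 1"
        using assms r by (intro powr_mono) auto
      finally have 1: "u powr \<gamma> * cmod w powr (-\<gamma>) \<le> 2 / (1 + r)"
        using r by simp
      have "u powr \<gamma> \<le> 2 powr \<gamma>"
        using u u0 assms by (intro powr_mono2) auto
      also have "\<dots> \<le> 2 powr 1"
        using assms by (intro powr_mono) auto
      finally have 2: "u powr \<gamma> * (\<epsilon> / 8) \<le> 2 * (\<epsilon> / 8)"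
        using assms by (intro mult_right_mono) auto
      have "\<bar>x\<bar> powr \<gamma> * \<bar>poly (bernstein_szego_poly N q) x\<bar> \<le> u powr \<gamma> * (2 * (cmod w powr (-\<gamma>) + \<epsilon> / 8))"
        unfolding u t using abs_poly_bernstein_szego_poly_le[OF elim, of t] Q
        by (intro mult_mono) (auto simp: u[unfolded t])
      also have "\<dots> \<le> 2 * (2 / (1 + r) + 2 * (\<epsilon> / 8))"
        using 1 2 by (simp add: algebra_simps)
      also have "\<dots> = 4 / (1 + r) + \<epsilon> / 2"
        by (simp add: algebra_simps)
      also have "\<dots> \<le> 2 + \<epsilon>"
        using r(3) by simp
      finally show ?thesis .
    qed
    with bernstein_szego_poly_monic[OF q(1) elim] show ?case
      by (intro exI[of _ "bernstein_szego_poly N q"]) auto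
  qed
qed

text \<open>Passing from \<open>Q\<close> to \<open>pCons 0 Q\<close>, which is \<open>x\<close>
  times \<open>Q\<close>, turns a weight into a divisor: with \<open>\<beta> = 1 - \<gamma>\<close>,
  the modulus of \<open>x * Q x\<close> is at most \<open>M\<close> times
  \<open>\<bar>x\<bar> powr \<beta>\<close>. The latter is nearly dominated by the modulus of a
  polynomial \<open>q\<close> close to \<open>(1 + r s) powr \<beta>\<close>, so the Bernstein-Szego
  bound applies in degree \<open>n + 1\<close>.\<close>

lemma weighted_monic_lower_bound:
  fixes \<gamma> \<epsilon> :: real
  assumes "0 \<le> \<gamma>" "\<gamma> < 1" "\<epsilon> > 0"
  shows "\<forall>\<^sub>F n in sequentially. \<forall>Q :: real poly. \<forall>M. degree Q = n \<longrightarrow> coeff Q n = 1 \<longrightarrow>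
           (\<forall>x\<in>{-2..2}. \<bar>x\<bar> powr \<gamma> * \<bar>poly Q x\<bar> \<le> M) \<longrightarrow> 2 - \<epsilon> \<le> M"
proof -
  define \<beta> where "\<beta> = 1 - \<gamma>"
  have \<beta>: "0 < \<beta>" "\<beta> \<le> 1"
    using assms by (auto simp: \<beta>_def)
  have "\<exists>r. 0 < r \<and> r < 1 \<and> 2 / (1 + r) \<le> 1 + \<epsilon> / 6"
    using assms(3) by (intro exI[of _ "1 / (1 + \<epsilon> / 6)"]) (auto simp: field_simps)
  then obtain r where r: "0 < r" "r < 1" "2 / (1 + r) \<le> 1 + \<epsilon> / 6"
    by auto
  define \<eta> where "\<eta> = min (\<epsilon> / 6) 1"
  have \<eta>: "0 < \<eta>" "\<eta> \<le> \<epsilon> / 6" "\<eta> \<le> 1"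
    using assms by (auto simp: \<eta>_def)
  \<comment> \<open>The real part of \<open>q\<close> on the circle is at least
    \<open>(1 - r) / 4\<close>, so this absolute error is a relative error of at most
    \<open>\<eta>\<close>.\<close>
  define \<delta> where "\<delta> = \<eta> * ((1 - r) / 4)"
  have \<delta>: "\<delta> > 0" "\<delta> \<le> (1 - r) / 4"
    using \<eta> r by (auto simp: \<delta>_def mult_le_cancel_right1)
  obtain q :: "real poly" where q: "coeff q 0 = 1"
    "\<And>s. cmod s \<le> 1 \<Longrightarrow> cmod (poly (map_poly of_real q) s - (1 + of_real r * s) powr of_real \<beta>) \<le> \<delta>"
    using binomial_poly_approx[OF r(1,2) \<delta>(1), of \<beta>] by auto
  \<comment> \<open>Here \<open>Re w \<ge> 1 - r\<close> and \<open>cmod w \<le> 2\<close> give the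
    bound \<open>(1 - r) / 2\<close> for the exact power; the approximation error takes at most half
    of it.\<close>
  have Re_ge: "Re (poly (map_poly of_real q) s) \<ge> (1 - r) / 4" if "cmod s = 1" for s
  proof -
    define w where "w = 1 + of_real r * s"
    have Re_s: "\<bar>Re s\<bar> \<le> 1"
      using abs_Re_le_cmod[of s] that by simp
    have "r * (- Re s) \<le> r * 1"
      using r Re_s by (intro mult_left_mono) auto
    then have Re: "Re w \<ge> 1 - r"
      by (simp add: w_def)
    have "cmod w \<le> 1 + r"
      using norm_triangle_ineq[of 1 "of_real r * s"] that r by (simp add: w_def norm_mult)
    then have cmod: "cmod w \<le> 2" "cmod w > 0"
      using r Re by auto
    have "1 / 2 \<le> 2 powr (\<beta> - 1)"
      using powr_mono[of "-1" "\<beta> - 1" 2] \<beta> by (simp add: powr_minus_divide)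
    also have "\<dots> \<le> cmod w powr (\<beta> - 1)"
      using cmod \<beta> by (intro powr_mono2') auto
    finally have "(1 - r) * (1 / 2) \<le> Re w * cmod w powr (\<beta> - 1)"
      using Re r by (intro mult_mono) auto
    also have "\<dots> \<le> Re (w powr of_real \<beta>)"
      using Re r \<beta> by (intro Re_powr_ge) auto
    finally have "(1 - r) / 2 \<le> Re (w powr of_real \<beta>)"
      by simp
    moreover have "\<bar>Re (poly (map_poly of_real q) s - w powr of_real \<beta>)\<bar> \<le> \<delta>"
      using q(2)[of s] that unfolding w_def by (intro order.trans[OF abs_Re_le_cmod]) simp
    ultimately show ?thesis
      using \<delta>(2) by simp
  qed
  have weight: "cmod (1 + cis (2 * t)) powr \<beta> \<le> (1 + \<epsilon> / 6)\<^sup>2 * cmod (poly (map_poly of_real q) (cis (2 * t)))" for t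
  proof -
    define u where "u = cmod (1 + cis (2 * t))"
    define w where "w = 1 + of_real r * cis (2 * t)"
    define v where "v = cmod (poly (map_poly of_real q) (cis (2 * t)))"
    have "cmod (of_real r * cis (2 * t)) < 1"
      using r by (simp add: norm_mult)
    then have w: "w \<noteq> 0"
      unfolding w_def by (metis add.commute add_eq_0_iff norm_minus_cancel norm_one order_less_irrefl)
    have uw: "u \<le> 2 / (1 + r) * cmod w"
      using one_plus_cis_le[OF r(1,2), of "2 * t"] r by (simp add: u_def w_def field_simps)
    have "v \<ge> (1 - r) / 4"
      using Re_ge[of "cis (2 * t)"] complex_Re_le_cmod[of "poly (map_poly of_real q) (cis (2 * t))"]
      by (simp add: v_def)
    then have "\<delta> \<le> \<eta> * v"
      using \<eta> by (simp add: \<delta>_def)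
    moreover have "cmod (w powr of_real \<beta>) \<le> v + \<delta>"
      using q(2)[of "cis (2 * t)"] norm_triangle_sub norm_minus_commute
      unfolding v_def w_def by (smt (verit) norm_cis)
    ultimately have wv: "cmod w powr \<beta> \<le> (1 + \<eta>) * v"
      using w by (simp add: cmod_powr_of_real algebra_simps)
    have "u powr \<beta> \<le> (2 / (1 + r) * cmod w) powr \<beta>"
      using uw \<beta> by (intro powr_mono2) (auto simp: u_def)
    also have "\<dots> = (2 / (1 + r)) powr \<beta> * cmod w powr \<beta>"
      using r by (subst powr_mult) auto
    also have "\<dots> \<le> (2 / (1 + r)) powr 1 * ((1 + \<eta>) * v)"
      using wv \<beta> r by (intro mult_mono powr_mono) auto
    also have "\<dots> \<le> (1 + \<epsilon> / 6) * ((1 + \<epsilon> / 6) * v)"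
      using r \<eta> assms by (intro mult_mono) (auto simp: v_def)
    finally show ?thesis
      by (simp add: u_def v_def power2_eq_square mult_ac)
  qed
  show ?thesis
    using eventually_gt_at_top[of "2 * degree q"]
  proof (eventually_elim, intro allI impI)
    fix n and Q :: "real poly" and M
    assume n: "2 * degree q < n" and Q: "degree Q = n" "coeff Q n = 1"
      and le: "\<forall>x\<in>{-2..2}. \<bar>x\<bar> powr \<gamma> * \<bar>poly Q x\<bar> \<le> M"
    have "\<bar>2\<bar> powr \<gamma> * \<bar>poly Q 2\<bar> \<le> M"
      by (rule bspec[OF le]) simp
    then have M: "M \<ge> 0"
      by (smt (verit) mult_nonneg_nonneg powr_ge_zero)
    have "Q \<noteq> 0"
      using Q by auto
    have "2 \<le> M * (1 + \<epsilon> / 6)\<^sup>2"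
    proof (rule bernstein_szego_lower_bound[OF q(1)])
      show "2 * degree q < Suc n"
        using n by simp
      show "degree (pCons 0 Q) = Suc n" "coeff (pCons 0 Q) (Suc n) = 1"
        using Q \<open>Q \<noteq> 0\<close> by auto
      show "0 < Re (poly (map_poly of_real q) s)" if "cmod s = 1" for s
        using Re_ge[OF that] r by simp
      show "\<bar>poly (pCons 0 Q) (2 * cos t)\<bar> \<le> M * (1 + \<epsilon> / 6)\<^sup>2 * cmod (poly (map_poly of_real q) (cis (2 * t)))" for t
      proof -
        define x where "x = 2 * cos t"
        have x: "x \<in> {-2..2}"
          using cos_ge_minus_one[of t] cos_le_one[of t] by (auto simp: x_def)
        \<comment> \<open>At \<open>x = 0\<close> both sides are 0, since
          \<open>0 powr a = 0\<close> for every \<open>a\<close>, including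
          \<open>a = 0\<close>.\<close>
        have "\<bar>x\<bar> = \<bar>x\<bar> powr \<beta> * \<bar>x\<bar> powr \<gamma>"
          by (cases "x = 0") (auto simp: \<beta>_def simp flip: powr_add)
        then have "\<bar>poly (pCons 0 Q) x\<bar> = \<bar>x\<bar> powr \<beta> * (\<bar>x\<bar> powr \<gamma> * \<bar>poly Q x\<bar>)"
          by (simp add: abs_mult)
        also have "\<dots> \<le> ((1 + \<epsilon> / 6)\<^sup>2 * cmod (poly (map_poly of_real q) (cis (2 * t)))) * M"
        proof (intro mult_mono)
          show "\<bar>x\<bar> powr \<beta> \<le> (1 + \<epsilon> / 6)\<^sup>2 * cmod (poly (map_poly of_real q) (cis (2 * t)))"
            unfolding x_def abs_two_cos by (rule weight)
          show "\<bar>x\<bar> powr \<gamma> * \<bar>poly Q x\<bar> \<le> M"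
            using le x by blast
        qed auto
        finally show ?thesis
          by (simp add: x_def mult_ac)
      qed
    qed
    show "2 - \<epsilon> \<le> M"
    proof (rule ccontr)
      assume "\<not> 2 - \<epsilon> \<le> M"
      then have "M < 2 - \<epsilon>"
        by simp
      with M have \<epsilon>: "\<epsilon> < 2"
        by simp
      \<comment> \<open>To first order the square adds \<open>2 * \<epsilon> / 3\<close>, which is
        less than the \<open>\<epsilon>\<close> that was subtracted.\<close>
      have "M * (1 + \<epsilon> / 6)\<^sup>2 \<le> (2 - \<epsilon>) * (1 + \<epsilon> / 6)\<^sup>2"
        using \<open>M < 2 - \<epsilon>\<close> by (intro mult_right_mono) auto
      also have "\<dots> = 2 - \<epsilon> / 3 - 5 * \<epsilon>\<^sup>2 / 18 - \<epsilon> ^ 3 / 36"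
        by (simp add: power2_eq_square power3_eq_cube field_simps)
      also have "\<dots> < 2"
        using assms(3) by (smt (verit) divide_pos_pos zero_less_power)
      finally show False
        using \<open>2 \<le> M * (1 + \<epsilon> / 6)\<^sup>2\<close> by simp
    qed
  qed
qed

section \<open>Logarithmic energy\<close>

text \<open>Induction on the number of points. For a monic \<open>p\<close> of degree
  \<open>card A - 1\<close> bounded by \<open>K\<close> the divided differences sum to 1, so some
  point \<open>a\<close> has a product of distances to the others of at most
  \<open>card A * K\<close>. Removing \<open>a\<close> takes this product out twice, once for each
  order of a pair.\<close>

lemma discriminant_le:
  fixes A :: "complex set"
  assumes "finite A" "A \<subseteq> E" "K > 0"
  assumes "\<And>d. \<exists>p. degree p = d \<and> lead_coeff p = 1 \<and> (\<forall>z\<in>E. cmod (poly p z) \<le> K)"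
  shows "(\<Prod>a\<in>A. \<Prod>b\<in>A - {a}. cmod (a - b)) \<le> (fact (card A) * K ^ card A)\<^sup>2"
  using assms(1,2)
proof (induction "card A" arbitrary: A)
  case 0
  then show ?case
    by simp
next
  case (Suc n)
  define W where "W A a = (\<Prod>b\<in>A - {a}. cmod (a - b))" for A a
  obtain p where p: "degree p = n" "lead_coeff p = 1" "\<And>z. z \<in> E \<Longrightarrow> cmod (poly p z) \<le> K"
    using assms(4) by blast
  have card: "card A = Suc n"
    using Suc.hyps(2) by simp
  have lead: "(\<Sum>a\<in>A. poly p a / (\<Prod>b\<in>A - {a}. a - b)) = 1"
    using lagrange_lead_coeff[of A p] p Suc.prems card by simp
  have "\<exists>a\<in>A. W A a \<le> Suc n * K"
  proof (rule ccontr)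
    assume "\<not> (\<exists>a\<in>A. W A a \<le> Suc n * K)"
    then have W: "W A a > Suc n * K" if "a \<in> A" for a
      using that by force
    have "1 = cmod (\<Sum>a\<in>A. poly p a / (\<Prod>b\<in>A - {a}. a - b))"
      unfolding lead by simp
    also have "\<dots> \<le> (\<Sum>a\<in>A. cmod (poly p a / (\<Prod>b\<in>A - {a}. a - b)))"
      by (rule norm_sum)
    also have "\<dots> < (\<Sum>a\<in>A. 1 / real (Suc n))"
    proof (rule sum_strict_mono)
      fix a assume a: "a \<in> A"
      have pos: "0 < real (Suc n) * K"
        using assms(3) by simp
      have "cmod (poly p a / (\<Prod>b\<in>A - {a}. a - b)) = cmod (poly p a) / W A a"
        by (simp add: norm_divide W_def prod_norm)
      also have "\<dots> \<le> K / W A a"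
        using less_trans[OF pos W[OF a]] p(3)[of a] a Suc.prems by (intro divide_right_mono) auto
      also have "\<dots> < K / (real (Suc n) * K)"
        using W[OF a] pos less_trans[OF pos W[OF a]] assms(3)
        by (intro divide_strict_left_mono mult_pos_pos) auto
      finally show "cmod (poly p a / (\<Prod>b\<in>A - {a}. a - b)) < 1 / real (Suc n)"
        using assms(3) by simp
    qed (use Suc.prems card in auto)
    also have "\<dots> = 1"
      by (simp add: card)
    finally show False
      by simp
  qed
  then obtain a where a: "a \<in> A" "W A a \<le> Suc n * K"
    by blast
  define B where "B = A - {a}"
  have B: "finite B" "a \<notin> B" "A = insert a B" "card B = n"
    using a Suc.prems card by (auto simp: B_def)
  have W_insert: "W A x = cmod (x - a) * W B x" if "x \<in> B" for x
  proof -
    have "A - {x} = insert a (B - {x})"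
      using B that by auto
    then show ?thesis
      using B by (simp add: W_def)
  qed
  have "(\<Prod>x\<in>A. W A x) = W A a * (\<Prod>x\<in>B. cmod (x - a) * W B x)"
    using B(1,2) W_insert by (subst B(3)) simp
  also have "(\<Prod>x\<in>B. cmod (x - a) * W B x) = W A a * (\<Prod>x\<in>B. W B x)"
    by (simp add: prod.distrib W_def[of A] norm_minus_commute flip: B_def)
  also have "W A a * (W A a * (\<Prod>x\<in>B. W B x)) = (W A a)\<^sup>2 * (\<Prod>x\<in>B. W B x)"
    by (simp add: power2_eq_square)
  also have "\<dots> \<le> (Suc n * K)\<^sup>2 * (fact n * K ^ n)\<^sup>2"
    using Suc.hyps(1)[of B] B a Suc.prems assms(3)
    by (intro mult_mono power_mono) (auto simp: W_def intro!: prod_nonneg)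
  also have "\<dots> = (fact (card A) * K ^ card A)\<^sup>2"
    by (simp add: card power_mult_distrib)
  finally show ?case
    by (simp add: W_def)
qed

text \<open>Once \<open>exp c\<close> bounds the diameter of the set, the shifted kernel is
  nonnegative there. The energy then needs one nonnegative integral in place of a difference of
  two.\<close>

definition shifted_kernel :: "real \<Rightarrow> complex \<Rightarrow> complex \<Rightarrow> ennreal" where
  "shifted_kernel c z w = e2ennreal (log_kernel z w + ereal c)"

lemma shifted_kernel_refl: "shifted_kernel c z z = \<top>"
  by (simp add: shifted_kernel_def log_kernel_def)

lemma shifted_kernel_neq: "z \<noteq> w \<Longrightarrow> shifted_kernel c z w = ennreal (c - ln (cmod (z - w)))"
  by (simp add: shifted_kernel_def log_kernel_def)

lemma borel_measurable_log_kernel [measurable (raw)]: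
  assumes [measurable]: "f \<in> borel_measurable M" "g \<in> borel_measurable M"
  shows "(\<lambda>x. log_kernel (f x) (g x)) \<in> borel_measurable M"
  unfolding log_kernel_def by measurable

lemma borel_measurable_e2ennreal [measurable (raw)]:
  assumes "f \<in> borel_measurable M"
  shows "(\<lambda>x. e2ennreal (f x)) \<in> borel_measurable M"
  using assms borel_measurable_continuous_onI[OF continuous_on_e2ennreal] by (rule measurable_compose)

lemma borel_measurable_shifted_kernel [measurable (raw)]:
  assumes [measurable]: "f \<in> borel_measurable M" "g \<in> borel_measurable M"
  shows "(\<lambda>x. shifted_kernel c (f x) (g x)) \<in> borel_measurable M"
  unfolding shifted_kernel_def by measurable

text \<open>Under a probability measure a constant \<open>c\<close> in the kernel adds
  \<open>c\<close> to the double integral. This gives \<open>P + c = S + Q\<close> for the positive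
  part \<open>P\<close>, the negative part \<open>Q\<close> and the shifted integral
  \<open>S\<close>.\<close>

lemma log_energy_eq_shifted:
  assumes \<mu>: "\<mu> \<in> prob_measures_on E" and E: "E \<in> sets borel" "\<And>z w. z \<in> E \<Longrightarrow> w \<in> E \<Longrightarrow> cmod (z - w) \<le> exp c"
    and c: "c \<ge> 0"
  shows "log_energy \<mu> = enn2ereal (\<integral>\<^sup>+z. \<integral>\<^sup>+w. shifted_kernel c z w \<partial>\<mu> \<partial>\<mu>) - ereal c"
proof -
  interpret prob_space \<mu>
    using \<mu> by (simp add: prob_measures_on_def)
  have [measurable_cong]: "sets \<mu> = sets borel"
    using \<mu> by (simp add: prob_measures_on_def)
  have AE_E: "AE z in \<mu>. z \<in> E"
  proof (rule AE_I)
    show "{z \<in> space \<mu>. z \<notin> E} \<subseteq> - E"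
      by auto
    show "emeasure \<mu> (- E) = 0" "- E \<in> sets \<mu>"
      using \<mu> E(1) by (auto simp: prob_measures_on_def)
  qed
  define P where "P = (\<integral>\<^sup>+z. \<integral>\<^sup>+w. e2ennreal (log_kernel z w) \<partial>\<mu> \<partial>\<mu>)"
  define Q where "Q = (\<integral>\<^sup>+z. \<integral>\<^sup>+w. e2ennreal (- log_kernel z w) \<partial>\<mu> \<partial>\<mu>)"
  define S where "S = (\<integral>\<^sup>+z. \<integral>\<^sup>+w. shifted_kernel c z w \<partial>\<mu> \<partial>\<mu>)"
  have lb: "ln (cmod (z - w)) \<le> c" if "z \<in> E" "w \<in> E" "z \<noteq> w" for z w
    using ln_mono[OF E(2)[OF that(1,2)]] that(3) by simp
  have pointwise: "e2ennreal (log_kernel z w) + ennreal c = shifted_kernel c z w + e2ennreal (- log_kernel z w)"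
    if "z \<in> E" "w \<in> E" for z w
  proof (cases "z = w")
    case True
    then show ?thesis
      by (simp add: log_kernel_def shifted_kernel_refl)
  next
    case False
    define r where "r = ln (cmod (z - w))"
    have "ennreal (- r) + ennreal c = ennreal (c - r) + ennreal r"
    proof (cases "r \<ge> 0")
      case True
      then show ?thesis
        using lb[OF that False] c
        by (simp add: ennreal_neg r_def flip: ennreal_plus)
    next
      case False
      then show ?thesis
        using c by (simp add: ennreal_neg flip: ennreal_plus)
    qed
    with False show ?thesis
      by (simp add: log_kernel_def shifted_kernel_neq r_def)
  qed
  have "P + ennreal c = (\<integral>\<^sup>+z. \<integral>\<^sup>+w. e2ennreal (log_kernel z w) + ennreal c \<partial>\<mu> \<partial>\<mu>)"
    by (simp add: P_def nn_integral_add emeasure_space_1)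
  also have "\<dots> = (\<integral>\<^sup>+z. \<integral>\<^sup>+w. shifted_kernel c z w + e2ennreal (- log_kernel z w) \<partial>\<mu> \<partial>\<mu>)"
    using AE_E
  proof (intro nn_integral_cong_AE, eventually_elim)
    case (elim z)
    show ?case
      using AE_E
    proof (intro nn_integral_cong_AE, eventually_elim)
      case (elim w)
      show ?case
        by (rule pointwise[OF \<open>z \<in> E\<close> \<open>w \<in> E\<close>])
    qed
  qed
  also have "\<dots> = S + Q"
    by (simp add: S_def Q_def nn_integral_add)
  finally have eq: "P + ennreal c = S + Q" .
  \<comment> \<open>Finiteness of \<open>Q\<close> allows it to be subtracted in the extended reals,
    also when \<open>P\<close> is infinite.\<close>
  have "Q \<le> (\<integral>\<^sup>+z. \<integral>\<^sup>+w. ennreal c \<partial>\<mu> \<partial>\<mu>)"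
    unfolding Q_def using AE_E
  proof (intro nn_integral_mono_AE, eventually_elim)
    case (elim z)
    show ?case
      using AE_E
    proof (intro nn_integral_mono_AE, eventually_elim)
      case (elim w)
      with \<open>z \<in> E\<close> lb show ?case
        by (cases "z = w") (auto simp: log_kernel_def e2ennreal_neg intro!: ennreal_leI)
    qed
  qed
  then have "Q \<le> ennreal c"
    by (simp add: emeasure_space_1)
  then obtain q where q: "Q = ennreal q" "q \<ge> 0"
    by (cases Q) (auto simp: top_unique)
  have "enn2ereal P - enn2ereal Q = enn2ereal S - ereal c"
  proof (cases P)
    case (real p)
    then have "S + ennreal q = ennreal (p + c)"
      using eq c q by (simp add: ennreal_plus)
    then obtain s where s: "S = ennreal s" "s \<ge> 0"
      by (cases S) auto
    with \<open>S + ennreal q = ennreal (p + c)\<close> q real c have "s + q = p + c"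
      by (simp flip: ennreal_plus)
    with s q real c show ?thesis
      by (simp add: enn2ereal_ennreal)
  next
    case top
    then have "S = \<top>"
      using eq q by (cases S) (auto simp flip: ennreal_plus)
    with top q show ?thesis
      by (simp add: enn2ereal_ennreal)
  qed
  then show ?thesis
    by (simp add: log_energy_def P_def Q_def S_def)
qed

section \<open>Lower bound for the energy from random points\<close>

lemma nn_integral_PiM_pair:
  fixes M :: "'i \<Rightarrow> 'a measure"
  assumes M: "\<And>i. prob_space (M i)" and I: "finite I" "i \<in> I" "j \<in> I" "i \<noteq> j"
    and f: "(\<lambda>(x, y). f x y) \<in> borel_measurable (M i \<Otimes>\<^sub>M M j)"
  shows "(\<integral>\<^sup>+x. f (x i) (x j) \<partial>PiM I M) = (\<integral>\<^sup>+x. \<integral>\<^sup>+y. f x y \<partial>M j \<partial>M i)"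
proof -
  interpret product_sigma_finite M
    using M by (simp add: product_sigma_finite_def prob_space_imp_sigma_finite)
  define J where "J = I - {i}"
  have J: "finite J" "i \<notin> J" "j \<in> J" "I = insert i J"
    using I by (auto simp: J_def)
  have meas: "(\<lambda>x. f (x i) (x j)) \<in> borel_measurable (PiM (insert i J) M)"
    using J measurable_compose[OF _ f, of "\<lambda>x. (x i, x j)" "PiM (insert i J) M"] by simp
  have "(\<integral>\<^sup>+x. f (x i) (x j) \<partial>PiM I M) = (\<integral>\<^sup>+y. \<integral>\<^sup>+x. f y (x j) \<partial>PiM J M \<partial>M i)"
    unfolding J(4) by (subst product_nn_integral_insert_rev[OF J(1,2) meas])
      (use J I in \<open>auto intro!: nn_integral_cong\<close>)
  also have "\<dots> = (\<integral>\<^sup>+y. \<integral>\<^sup>+z. f y z \<partial>M j \<partial>M i)"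
  proof (rule nn_integral_cong)
    fix y assume "y \<in> space (M i)"
    then have "f y \<in> borel_measurable (M j)"
      using measurable_Pair2[OF f, of y] by simp
    then have "(\<integral>\<^sup>+z. f y z \<partial>distr (PiM J M) (M j) (\<lambda>x. x j)) = (\<integral>\<^sup>+x. f y (x j) \<partial>PiM J M)"
      using J by (subst nn_integral_distr) auto
    then show "(\<integral>\<^sup>+x. f y (x j) \<partial>PiM J M) = (\<integral>\<^sup>+z. f y z \<partial>M j)"
      using M J by (subst (asm) distr_PiM_component) auto
  qed
  finally show ?thesis .
qed

text \<open>
  The energy is estimated from below by averaging the discrete energy of \<open>n\<close> independent
  random points; coinciding points cost infinite energy.
\<close>

lemma log_energy_nonneg:
  assumes E: "E \<in> sets borel" "bounded E"
    and polys: "\<And>d. \<exists>p. degree p = d \<and> lead_coeff p = 1 \<and> (\<forall>z\<in>E. cmod (poly p z) \<le> K)"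
    and \<mu>: "\<mu> \<in> prob_measures_on E"
  shows "log_energy \<mu> \<ge> 0"
proof -
  interpret prob_space \<mu>
    using \<mu> by (simp add: prob_measures_on_def)
  have [measurable_cong]: "sets \<mu> = sets borel"
    using \<mu> by (simp add: prob_measures_on_def)
  have AE_E: "AE z in \<mu>. z \<in> E"
  proof (rule AE_I)
    show "{z \<in> space \<mu>. z \<notin> E} \<subseteq> - E"
      by auto
    show "emeasure \<mu> (- E) = 0" "- E \<in> sets \<mu>"
      using \<mu> E(1) by (auto simp: prob_measures_on_def)
  qed
  define K' where "K' = max K 1"
  have K': "K' \<ge> 1" "\<And>d. \<exists>p. degree p = d \<and> lead_coeff p = 1 \<and> (\<forall>z\<in>E. cmod (poly p z) \<le> K')"
    using polys by (auto simp: K'_def) (meson max.coboundedI1)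
  obtain B where B: "\<And>z. z \<in> E \<Longrightarrow> cmod z \<le> B"
    using E(2) by (auto simp: bounded_iff)
  \<comment> \<open>The maximum with 1 makes \<open>c\<close> nonnegative, and \<open>exp c\<close>
    bounds the diameter of \<open>E\<close>.\<close>
  define c where "c = ln (max 1 (2 * B))"
  have c: "c \<ge> 0"
    by (simp add: c_def)
  have diam: "cmod (z - w) \<le> exp c" if "z \<in> E" "w \<in> E" for z w
    using norm_triangle_ineq4[of z w] B[OF that(1)] B[OF that(2)] by (simp add: c_def)
  define S where "S = (\<integral>\<^sup>+z. \<integral>\<^sup>+w. shifted_kernel c z w \<partial>\<mu> \<partial>\<mu>)"
  \<comment> \<open>The integral of a pointwise bound for \<open>n\<close> points: each of the
    \<open>n * (n - 1)\<close> ordered pairs contributes \<open>c\<close>, and the logarithms of the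
    distances sum to at most the logarithm of the discriminant bound.\<close>
  have lower: "ennreal (real n * real (n - 1) * c - 2 * ln (fact n * K' ^ n)) \<le> of_nat n * (of_nat (n - 1) * S)" for n
  proof -
    define I where "I = {..<n}"
    define F where "F x = (\<Sum>i\<in>I. \<Sum>j\<in>I - {i}. shifted_kernel c (x i) (x j))" for x
    define M where "M = PiM I (\<lambda>_. \<mu>)"
    interpret M: prob_space M
      unfolding M_def by (intro prob_space_PiM prob_space_axioms)
    have I: "finite I" "card I = n"
      by (auto simp: I_def)
    have pointwise: "ennreal (real n * real (n - 1) * c - 2 * ln (fact n * K' ^ n)) \<le> F x"
      if x: "\<And>i. i \<in> I \<Longrightarrow> x i \<in> E" for x
    proof (cases "inj_on x I")
      case False
      then obtain i j where ij: "i \<in> I" "j \<in> I - {i}" "x i = x j"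
        by (auto simp: inj_on_def)
      have "shifted_kernel c (x i) (x j) \<le> (\<Sum>j\<in>I - {i}. shifted_kernel c (x i) (x j))"
        using I ij by (intro member_le_sum) auto
      also have "\<dots> \<le> F x"
        unfolding F_def using I ij by (intro member_le_sum) auto
      finally show ?thesis
        using ij by (simp add: shifted_kernel_refl top_unique)
    next
      case True
      define D where "D = (\<Prod>a\<in>x ` I. \<Prod>b\<in>x ` I - {a}. cmod (a - b))"
      have D_eq: "D = (\<Prod>i\<in>I. \<Prod>j\<in>I - {i}. cmod (x i - x j))"
        unfolding D_def prod.reindex[OF True] o_def
      proof (intro prod.cong refl)
        fix i assume "i \<in> I"
        then have "x ` I - {x i} = x ` (I - {i})"
          using True by (auto simp: inj_on_def)
        then show "(\<Prod>b\<in>x ` I - {x i}. cmod (x i - b)) = (\<Prod>j\<in>I - {i}. cmod (x i - x j))"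
          using True by (simp add: prod.reindex inj_on_diff)
      qed
      have neq: "x i \<noteq> x j" if "i \<in> I" "j \<in> I - {i}" for i j
        using True that by (auto simp: inj_on_def)
      have "D > 0"
        unfolding D_eq using neq by (intro prod_pos) auto
      have "D \<le> (fact (card (x ` I)) * K' ^ card (x ` I))\<^sup>2"
        unfolding D_def using I x K' by (intro discriminant_le[of _ E]) auto
      also have "card (x ` I) = n"
        using True I by (simp add: card_image)
      finally have "ln D \<le> ln ((fact n * K' ^ n)\<^sup>2)"
        using \<open>D > 0\<close> by (subst ln_le_cancel_iff) (use K' in auto)
      then have lnD: "ln D \<le> 2 * ln (fact n * K' ^ n)"
        using K' by (simp add: ln_realpow)
      have "F x = (\<Sum>i\<in>I. \<Sum>j\<in>I - {i}. ennreal (c - ln (cmod (x i - x j))))"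
        unfolding F_def using neq by (intro sum.cong) (auto simp: shifted_kernel_neq)
      also have "\<dots> = ennreal (\<Sum>i\<in>I. \<Sum>j\<in>I - {i}. c - ln (cmod (x i - x j)))"
      proof -
        have nonneg: "c - ln (cmod (x i - x j)) \<ge> 0" if "i \<in> I" "j \<in> I - {i}" for i j
          using ln_mono[OF diam[of "x i" "x j"]] x neq[OF that] that by simp
        have "(\<Sum>j\<in>I - {i}. ennreal (c - ln (cmod (x i - x j)))) = ennreal (\<Sum>j\<in>I - {i}. c - ln (cmod (x i - x j)))"
          if "i \<in> I" for i
          using nonneg that by (intro sum_ennreal) auto
        then have "(\<Sum>i\<in>I. \<Sum>j\<in>I - {i}. ennreal (c - ln (cmod (x i - x j)))) =
            (\<Sum>i\<in>I. ennreal (\<Sum>j\<in>I - {i}. c - ln (cmod (x i - x j))))"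
          by (intro sum.cong) auto
        also have "\<dots> = ennreal (\<Sum>i\<in>I. \<Sum>j\<in>I - {i}. c - ln (cmod (x i - x j)))"
          using nonneg by (intro sum_ennreal sum_nonneg) auto
        finally show ?thesis .
      qed
      also have "(\<Sum>i\<in>I. \<Sum>j\<in>I - {i}. c - ln (cmod (x i - x j))) = real n * real (n - 1) * c - ln D"
      proof -
        have "ln D = (\<Sum>i\<in>I. ln (\<Prod>j\<in>I - {i}. cmod (x i - x j)))"
          unfolding D_eq using I neq by (intro ln_prod) (auto intro!: prod_pos)
        also have "\<dots> = (\<Sum>i\<in>I. \<Sum>j\<in>I - {i}. ln (cmod (x i - x j)))"
          using I neq by (intro sum.cong refl ln_prod) auto
        finally show ?thesis
          using I by (simp add: sum_subtractf)
      qed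
      finally show ?thesis
        using lnD by (auto intro!: ennreal_leI)
    qed
    have "AE x in M. \<forall>i\<in>I. x i \<in> E"
      unfolding M_def using I AE_E prob_space_axioms
      by (intro AE_finite_allI AE_PiM_component) auto
    then have "AE x in M. ennreal (real n * real (n - 1) * c - 2 * ln (fact n * K' ^ n)) \<le> F x"
      by eventually_elim (rule pointwise, blast)
    then have "(\<integral>\<^sup>+x. ennreal (real n * real (n - 1) * c - 2 * ln (fact n * K' ^ n)) \<partial>M) \<le> (\<integral>\<^sup>+x. F x \<partial>M)"
      by (rule nn_integral_mono_AE)
    also have "(\<integral>\<^sup>+x. F x \<partial>M) = (\<Sum>i\<in>I. \<Sum>j\<in>I - {i}. \<integral>\<^sup>+x. shifted_kernel c (x i) (x j) \<partial>M)"
    proof -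
      have meas: "(\<lambda>x. shifted_kernel c (x i) (x j)) \<in> borel_measurable M" if "i \<in> I" "j \<in> I" for i j
        unfolding M_def using that by measurable
      have "(\<integral>\<^sup>+x. F x \<partial>M) = (\<Sum>i\<in>I. \<integral>\<^sup>+x. (\<Sum>j\<in>I - {i}. shifted_kernel c (x i) (x j)) \<partial>M)"
        unfolding F_def by (intro nn_integral_sum borel_measurable_sum meas) auto
      also have "\<dots> = (\<Sum>i\<in>I. \<Sum>j\<in>I - {i}. \<integral>\<^sup>+x. shifted_kernel c (x i) (x j) \<partial>M)"
        by (intro sum.cong refl nn_integral_sum meas) auto
      finally show ?thesis .
    qed
    also have "\<dots> = (\<Sum>i\<in>I. \<Sum>j\<in>I - {i}. S)"
      unfolding M_def S_def using I prob_space_axioms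
      by (intro sum.cong refl nn_integral_PiM_pair) (auto simp: case_prod_beta')
    also have "\<dots> = of_nat n * (of_nat (n - 1) * S)"
      using I by simp
    finally show ?thesis
      by (simp add: M.emeasure_space_1)
  qed
  have "ennreal c \<le> S"
  proof (cases S)
    case (real s)
    \<comment> \<open>Division by \<open>n * (n - 1)\<close>, with
      \<open>fact n \<le> n ^ n\<close>, leaves an error that tends to 0.\<close>
    have "c - 2 * (ln (real n) + ln K') / (real n - 1) \<le> s" if n: "n \<ge> 2" for n
    proof -
      have "ennreal (real n * real (n - 1) * c - 2 * ln (fact n * K' ^ n)) \<le> ennreal (real n * (real (n - 1) * s))"
        using lower[of n] real by (simp add: ennreal_mult flip: ennreal_of_nat_eq_real_of_nat)
      then have 1: "real n * (real n - 1) * c - 2 * ln (fact n * K' ^ n) \<le> real n * (real n - 1) * s"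
        using real n by (subst (asm) ennreal_le_iff) (auto simp: of_nat_diff mult.assoc)
      have "ln (fact n * K' ^ n) = ln (fact n) + real n * ln K'"
        using K' by (simp add: ln_mult ln_realpow)
      also have "ln (fact n) \<le> ln (real n ^ n)"
        using n fact_le_power[of n, where ?'a = real] by (subst ln_le_cancel_iff) auto
      also have "\<dots> = real n * ln (real n)"
        using n by (simp add: ln_realpow)
      finally have "real n * (real n - 1) * c - 2 * (real n * (ln (real n) + ln K')) \<le> real n * (real n - 1) * s"
        using 1 by (simp add: algebra_simps)
      then have "real n * ((real n - 1) * c - 2 * (ln (real n) + ln K')) \<le> real n * ((real n - 1) * s)"
        by (simp add: algebra_simps)
      then have "(real n - 1) * c - 2 * (ln (real n) + ln K') \<le> (real n - 1) * s"
        using n by (subst (asm) mult_le_cancel_left_pos) auto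
      then show ?thesis
        using n by (simp add: field_simps)
    qed
    moreover have "(\<lambda>n. c - 2 * (ln (real n) + ln K') / (real n - 1)) \<longlonglongrightarrow> c"
      by real_asymp
    ultimately have "c \<le> s"
      by (intro LIMSEQ_le_const2) auto
    with real show ?thesis
      by (simp add: ennreal_leI)
  qed auto
  then have "enn2ereal (ennreal c) \<le> enn2ereal S"
    by (simp add: less_eq_ennreal.rep_eq)
  with c have "ereal c \<le> enn2ereal S"
    by (simp add: enn2ereal_ennreal)
  then have "0 \<le> enn2ereal S - ereal c"
    by (simp add: ereal_diff_positive)
  then show ?thesis
    using log_energy_eq_shifted[OF \<mu> E(1) diam c] by (simp add: S_def)
qed

section \<open>The potential of the arcsine law\<close>

lemma mean_value_ln_cmod:
  assumes "cmod b < 1"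
  shows "((\<lambda>t. ln (cmod (1 - b * cis (2 * pi * t)))) has_integral 0) {0..1}"
proof -
  \<comment> \<open>This branch is holomorphic on the closed disc and vanishes at 0, so Cauchy's
    formula at the centre gives circle mean 0. The claim is the real part.\<close>
  define f where "f u = Ln (1 - b * u)" for u
  have small: "cmod (b * u) < 1" if "cmod u \<le> 1" for u
  proof -
    have "cmod (b * u) \<le> cmod b * 1"
      using that unfolding norm_mult by (intro mult_left_mono) auto
    with assms show ?thesis
      by simp
  qed
  have pos: "1 - b * u \<notin> \<real>\<^sub>\<le>\<^sub>0" if "cmod u \<le> 1" for u
  proof -
    have "Re (b * u) < 1"
      using small[OF that] complex_Re_le_cmod[of "b * u"] by linarith
    then show ?thesis
      by (auto elim!: nonpos_Reals_cases simp: complex_eq_iff)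
  qed
  have "f holomorphic_on cball 0 1"
    unfolding f_def using pos by (intro holomorphic_intros) auto
  from Cauchy_integral_circlepath_simple[OF this, of 0]
  have "((\<lambda>u. f u / u) has_contour_integral 0) (circlepath 0 1)"
    by (simp add: f_def)
  then have "((\<lambda>t. f (circlepath 0 1 t) / circlepath 0 1 t *
                vector_derivative (circlepath 0 1) (at t within {0..1})) has_integral 0) {0..1}"
    by (simp add: has_contour_integral_def)
  moreover have "f (circlepath 0 1 t) / circlepath 0 1 t *
      vector_derivative (circlepath 0 1) (at t within {0..1}) = 2 * pi * \<i> * f (cis (2 * pi * t))"
    if "t \<in> {0..1}" for t
  proof -
    have "exp (2 * of_real pi * \<i> * of_real t) = cis (2 * pi * t)"
      by (simp add: cis_conv_exp mult_ac)
    then show ?thesis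
      using that by (simp add: vector_derivative_circlepath01) (simp add: circlepath)
  qed
  ultimately have "((\<lambda>t. 2 * pi * \<i> * f (cis (2 * pi * t))) has_integral 0) {0..1}"
    by (rule has_integral_eq[rotated])
  from has_integral_mult_right[OF this, of "1 / (2 * pi * \<i>)"]
  have "((\<lambda>t. f (cis (2 * pi * t))) has_integral 0) {0..1}"
    by simp
  then have "((\<lambda>t. Re (f (cis (2 * pi * t)))) has_integral Re 0) {0..1}"
    by (rule has_integral_Re)
  moreover have "Re (f (cis (2 * pi * t))) = ln (cmod (1 - b * cis (2 * pi * t)))" for t
  proof -
    have "1 - b * cis (2 * pi * t) \<noteq> 0"
      using pos[of "cis (2 * pi * t)"] by (metis nonpos_Reals_zero_I norm_cis order_refl)
    then show ?thesis
      by (simp add: f_def)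
  qed
  ultimately show ?thesis
    by simp
qed

text \<open>Taking the limit in the extended reals recovers the infinite value of the kernel on the
  diagonal, where the convention \<open>ln 0 = 0\<close> would give a wrong one.\<close>

lemma tendsto_minus_ln_ereal:
  assumes "(u \<longlongrightarrow> l) F" "eventually (\<lambda>x. u x > 0) F" "l \<ge> (0::real)"
  shows "((\<lambda>x. ereal (c - ln (u x))) \<longlongrightarrow> (if l = 0 then \<infinity> else ereal (c - ln l))) F"
proof (cases "l = 0")
  case False
  with assms show ?thesis
    by (auto intro!: tendsto_intros)
next
  case True
  with assms have "filterlim u (at_right 0) F"
    by (auto simp: filterlim_at elim: eventually_mono)
  then have "filterlim (\<lambda>x. ln (u x)) at_bot F"
    by (rule filterlim_compose[OF ln_at_0])
  then have "filterlim (\<lambda>x. c + (- ln (u x))) at_top F"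
    by (intro filterlim_tendsto_add_at_top[OF tendsto_const]) (simp add: filterlim_uminus_at_top)
  with True show ?thesis
    by (simp add: tendsto_PInfty_eq_at_top)
qed

lemma diff_two_cos:
  "complex_of_real (2 * cos s) - of_real (2 * cos t) = cis (- s) * ((1 - cis (s + t)) * (1 - cis (s - t)))"
proof -
  have *: "x * ((1 - a) * (1 - b)) = x + x * a * b - x * a - x * b" for x a b :: complex
    by (simp add: algebra_simps)
  have "cis (- s) * ((1 - cis (s + t)) * (1 - cis (s - t))) =
          cis (- s) + cis (- s) * cis (s + t) * cis (s - t) - cis (- s) * cis (s + t) - cis (- s) * cis (s - t)"
    by (rule *)
  also have "\<dots> = cis (- s) + cis s - cis t - cis (- t)"
    by (simp add: cis_mult)
  finally show ?thesis
    by (simp add: complex_eq_iff)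
qed

text \<open>The distance on \<open>[-2, 2]\<close> splits into two factors \<open>1 - b * u\<close>
  with \<open>u = cis t\<close> and \<open>cmod b = 1\<close>, the boundary case of the mean value
  property.\<close>

lemma cmod_diff_two_cos:
  "cmod (of_real (2 * cos s) - of_real (2 * cos t)) = cmod (1 - cis s * cis t) * cmod (1 - cis (- s) * cis t)"
proof -
  have "1 - cis (s - t) = - cis (s - t) * (1 - cis (- s) * cis t)"
    by (simp add: cis_mult algebra_simps)
  then have "cmod (1 - cis (s - t)) = cmod (1 - cis (- s) * cis t)"
    by (simp only: norm_mult norm_minus_cancel norm_cis mult_1)
  then show ?thesis
    unfolding diff_two_cos norm_mult norm_minus_cancel norm_cis by (simp add: cis_mult)
qed

text \<open>
  Fatou's lemma turns the mean value property of \<open>ln (cmod (1 - b * u))\<close> for \<open>cmod b < 1\<close>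
  into the bound for the potential on the boundary, where the kernel is singular.
\<close>

lemma arcsine_potential_le:
  assumes C: "C \<ge> ln 4"
  shows "(\<integral>\<^sup>+t. shifted_kernel C (of_real (2 * cos s)) (of_real (2 * cos (2 * pi * t))) * indicator {0..1} t \<partial>lborel) \<le> ennreal C"
proof -
  define r where "r n = 1 - 1 / (real n + 2)" for n
  have r: "0 < r n" "r n < 1" for n
    by (auto simp: r_def field_simps)
  have r_lim: "r \<longlonglongrightarrow> 1"
    unfolding r_def by real_asymp
  define u where "u n t = cmod (1 - of_real (r n) * cis s * cis (2 * pi * t)) *
    cmod (1 - of_real (r n) * cis (- s) * cis (2 * pi * t))" for n t
  have factor: "0 < cmod (1 - of_real (r n) * cis a * cis b)" "cmod (1 - of_real (r n) * cis a * cis b) \<le> 2" for n a b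
  proof -
    have "cmod (of_real (r n) * cis a * cis b) < 1"
      using r[of n] by (simp add: norm_mult)
    then show "0 < cmod (1 - of_real (r n) * cis a * cis b)" "cmod (1 - of_real (r n) * cis a * cis b) \<le> 2"
      using norm_triangle_ineq4[of 1 "of_real (r n) * cis a * cis b"] by auto
  qed
  have u: "0 < u n t" "u n t \<le> 2 * 2" for n t
    using factor(1)[of n s "2 * pi * t"] factor(1)[of n "- s" "2 * pi * t"]
      mult_mono[OF factor(2)[of n s "2 * pi * t"] factor(2)[of n "- s" "2 * pi * t"]]
    by (simp_all add: u_def)
  \<comment> \<open>Both factors of \<open>u\<close> are at most 2, hence the assumption on
    \<open>ln 4\<close>. Nonnegativity identifies the integral in \<open>int\<close> with a
    nonnegative Lebesgue integral.\<close>
  have nonneg: "C - ln (u n t) \<ge> 0" for n t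
    using ln_mono[OF u(2) u(1), of n t] C by simp
  have int: "((\<lambda>t. C - ln (u n t)) has_integral C) {0..1}" for n
  proof -
    have "((\<lambda>t. C - (ln (cmod (1 - of_real (r n) * cis s * cis (2 * pi * t))) +
             ln (cmod (1 - of_real (r n) * cis (- s) * cis (2 * pi * t))))) has_integral (C - (0 + 0))) {0..1}"
      using r[of n] has_integral_const_real[of C 0 1]
      by (intro has_integral_diff has_integral_add mean_value_ln_cmod) (auto simp: norm_mult)
    moreover have "ln (u n t) = ln (cmod (1 - of_real (r n) * cis s * cis (2 * pi * t))) +
             ln (cmod (1 - of_real (r n) * cis (- s) * cis (2 * pi * t)))" for t
      unfolding u_def using factor[of n] by (subst ln_mult_pos) auto
    ultimately show ?thesis
      by simp
  qed
  have "(\<lambda>n. ennreal (C - ln (u n t)) * indicator {0..1} t) \<longlonglongrightarrow>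
          shifted_kernel C (of_real (2 * cos s)) (of_real (2 * cos (2 * pi * t))) * indicator {0..1} t" for t
  proof -
    define d where "d = cmod (of_real (2 * cos s) - of_real (2 * cos (2 * pi * t)))"
    have "(\<lambda>n. u n t) \<longlonglongrightarrow> cmod (1 - of_real 1 * cis s * cis (2 * pi * t)) *
            cmod (1 - of_real 1 * cis (- s) * cis (2 * pi * t))"
      unfolding u_def by (intro tendsto_intros r_lim)
    then have "(\<lambda>n. u n t) \<longlonglongrightarrow> d"
      unfolding d_def cmod_diff_two_cos by simp
    then have "(\<lambda>n. ereal (C - ln (u n t))) \<longlonglongrightarrow> (if d = 0 then \<infinity> else ereal (C - ln d))"
      using u by (intro tendsto_minus_ln_ereal) (auto simp: d_def)
    then have "(\<lambda>n. e2ennreal (ereal (C - ln (u n t)))) \<longlonglongrightarrow> e2ennreal (if d = 0 then \<infinity> else ereal (C - ln d))"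
      by (rule tendsto_e2ennrealI)
    also have "e2ennreal (if d = 0 then \<infinity> else ereal (C - ln d)) =
                 shifted_kernel C (of_real (2 * cos s)) (of_real (2 * cos (2 * pi * t)))"
      by (auto simp: d_def shifted_kernel_def log_kernel_def)
    finally show ?thesis
      by (auto simp: indicator_def)
  qed
  then have "(\<integral>\<^sup>+t. shifted_kernel C (of_real (2 * cos s)) (of_real (2 * cos (2 * pi * t))) * indicator {0..1} t \<partial>lborel) =
          (\<integral>\<^sup>+t. liminf (\<lambda>n. ennreal (C - ln (u n t)) * indicator {0..1} t) \<partial>lborel)"
    by (intro nn_integral_cong lim_imp_Liminf[symmetric]) auto
  also have "\<dots> \<le> liminf (\<lambda>n. \<integral>\<^sup>+t. ennreal (C - ln (u n t)) * indicator {0..1} t \<partial>lborel)"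
  proof (intro nn_integral_liminf)
    fix n
    have [measurable]: "u n \<in> borel_measurable borel"
      unfolding u_def cis_conv_exp by (intro borel_measurable_continuous_onI continuous_intros)
    show "(\<lambda>t. ennreal (C - ln (u n t)) * indicator {0..1} t) \<in> borel_measurable lborel"
      by measurable
  qed
  also have "(\<lambda>n. \<integral>\<^sup>+t. ennreal (C - ln (u n t)) * indicator {0..1} t \<partial>lborel) = (\<lambda>_. ennreal C)"
    using nonneg int by (intro ext nn_integral_has_integral_lebesgue') auto
  finally show ?thesis
    by (simp add: Liminf_const)
qed

text \<open>As polynomials in \<open>z\<close> both sides are monic of degree \<open>m\<close> and
  vanish at the points \<open>u * c\<close>. These are distinct only for nonzero \<open>c\<close>,
  hence the case split.\<close>

lemma prod_diff_roots_unity: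
  assumes "m > 0"
  shows "(\<Prod>u\<in>{u::complex. u ^ m = 1}. z - u * c) = z ^ m - c ^ m"
proof (cases "c = 0")
  case True
  with assms show ?thesis
    by (simp add: card_roots_unity_eq)
next
  case False
  define U where "U = {u::complex. u ^ m = 1}"
  have U: "finite U" "card U = m"
    using assms by (auto simp: U_def card_roots_unity_eq finite_roots_unity)
  define p where "p = (\<Prod>u\<in>U. [:- (u * c), 1:])"
  have deg: "degree p = m"
    unfolding p_def using U by (subst degree_prod_eq_sum_degree) auto
  moreover have "lead_coeff p = 1"
    unfolding p_def lead_coeff_prod by simp
  moreover have "degree (monom 1 m - [:c ^ m:]) = m"
  proof -
    have "monom 1 m - [:c ^ m:] = monom 1 m + [:- (c ^ m):]"
      by simp
    also have "degree \<dots> = degree (monom (1::complex) m)"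
      using assms by (intro degree_add_eq_left) (simp add: degree_monom_eq)
    finally show ?thesis
      by (simp add: degree_monom_eq)
  qed
  moreover have "coeff (monom 1 m - [:c ^ m:]) m = 1"
    using assms by (auto simp: coeff_pCons split: nat.splits)
  moreover have "card ((\<lambda>u. u * c) ` U) = m"
    using U False by (subst card_image) (auto simp: inj_on_def)
  ultimately have "p = monom 1 m - [:c ^ m:]"
  proof (intro poly_eqI_degree_lead_coeff[of _ m _ "(\<lambda>u. u * c) ` U"])
    fix z assume "z \<in> (\<lambda>u. u * c) ` U"
    then obtain u where u: "u \<in> U" "z = u * c"
      by auto
    then have "poly p z = 0"
      using U by (auto simp: p_def poly_prod)
    with u show "poly p z = poly (monom 1 m - [:c ^ m:]) z"
      by (simp add: U_def poly_monom power_mult_distrib)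
  qed auto
  moreover have "poly p z = (\<Prod>u\<in>U. z - u * c)"
    by (simp add: p_def poly_prod)
  ultimately show ?thesis
    by (simp add: poly_monom U_def)
qed

section \<open>Capacity of the star-shaped sets\<close>

text \<open>A measurable choice of an \<open>m\<close>-th root for every real number; for negative
  \<open>y\<close> the ray is turned by \<open>pi / m\<close>, whose \<open>m\<close>-th multiple
  produces the sign.\<close>

definition signed_root :: "nat \<Rightarrow> real \<Rightarrow> complex" where
  "signed_root m y = of_real (root m \<bar>y\<bar>) * (if y \<ge> 0 then 1 else cis (pi / real m))"

lemma signed_root_power:
  assumes "m > 0"
  shows "signed_root m y ^ m = of_real y"
proof -
  have "complex_of_real (root m \<bar>y\<bar>) ^ m = of_real \<bar>y\<bar>"
    using assms by (simp flip: of_real_power)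
  moreover have "cis (pi / real m) ^ m = -1"
    using assms by (simp add: Complex.DeMoivre)
  ultimately show ?thesis
    by (auto simp: signed_root_def power_mult_distrib)
qed

lemma borel_measurable_signed_root [measurable (raw)]:
  assumes [measurable]: "f \<in> borel_measurable M"
  shows "(\<lambda>x. signed_root m (f x)) \<in> borel_measurable M"
proof -
  have [measurable]: "root m \<in> borel_measurable borel"
    by (intro borel_measurable_continuous_onI continuous_intros)
  show ?thesis
    unfolding signed_root_def by measurable
qed

section \<open>The star as a compact set, and its equilibrium measure\<close>

lemma mem_star_set_iff: "z \<in> star_set m \<longleftrightarrow> (\<exists>x\<in>{-2..2}. z ^ m = of_real x)"
  by (auto simp: star_set_def)

lemma star_set_norm_power_le:
  assumes "z \<in> star_set m"
  shows "cmod z ^ m \<le> 2"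
proof -
  obtain x :: real where "x \<in> {-2..2}" "z ^ m = of_real x"
    using assms by (auto simp: mem_star_set_iff)
  then show ?thesis
    by (auto simp flip: norm_power)
qed

lemma star_set_norm_power_le':
  assumes "z \<in> star_set m" "l \<le> m"
  shows "cmod z ^ l \<le> 2"
proof (cases "cmod z \<le> 1")
  case True
  then have "cmod z ^ l \<le> 1"
    by (simp add: power_le_one)
  then show ?thesis
    by simp
next
  case False
  then have "cmod z ^ l \<le> cmod z ^ m"
    using assms by (intro power_increasing) auto
  with star_set_norm_power_le[OF assms(1)] show ?thesis
    by simp
qed

lemma compact_star_set:
  assumes "m > 0"
  shows "compact (star_set m)"
proof -
  have "closed (complex_of_real ` {-2..2})"
    by (intro compact_imp_closed compact_continuous_image continuous_intros compact_Icc)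
  then have "closed ((\<lambda>z. z ^ m) -` (complex_of_real ` {-2..2}))"
    by (intro continuous_closed_vimage continuous_intros)
  then have "closed (star_set m)"
    by (simp add: star_set_def vimage_def)
  moreover have "bounded (star_set m)"
    using star_set_norm_power_le'[of _ m 1] assms by (intro boundedI[of _ 2]) auto
  ultimately show ?thesis
    by (simp add: compact_eq_bounded_closed)
qed

lemma infinite_star_set: "infinite (star_set m)"
proof -
  have "complex_of_real ` {0..1} \<subseteq> star_set m"
  proof safe
    fix x :: real assume "x \<in> {0..1}"
    then have "x ^ m \<in> {-2..2}"
      using power_le_one[of x m] zero_le_power[of x m] by (auto intro: order_trans[of "-2" 0])
    then show "complex_of_real x \<in> star_set m"
      unfolding mem_star_set_iff by (intro bexI[of _ "x ^ m"]) auto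
  qed
  moreover have "infinite (complex_of_real ` {0..1})"
    by (subst finite_image_iff) (auto simp: inj_on_def infinite_Icc)
  ultimately show ?thesis
    using finite_subset by blast
qed

text \<open>The \<open>m\<close>-th power of the random point follows the arcsine law, the
  equilibrium measure of \<open>[-2, 2]\<close>; the independent uniform root of unity distributes
  it evenly over the \<open>m\<close> preimages.\<close>

definition star_equilibrium :: "nat \<Rightarrow> complex measure" where
  "star_equilibrium m = distr (measure_pmf (pmf_of_set {u. u ^ m = 1}) \<Otimes>\<^sub>M uniform_measure lborel {0..1}) borel
     (\<lambda>(u, t). u * signed_root m (2 * cos (2 * pi * t)))"

lemma prob_space_uniform_unit: "prob_space (uniform_measure lborel {0..1::real})"
  by (intro prob_space_uniform_measure) auto

lemma measurable_star_param [measurable]: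
  "(\<lambda>(u, t). u * signed_root m (2 * cos (2 * pi * t))) \<in>
     borel_measurable (measure_pmf p \<Otimes>\<^sub>M uniform_measure lborel {0..1})"
proof -
  \<comment> \<open>A \<open>measure_pmf\<close> carries the sigma-algebra of all sets, so the
    change to \<open>borel\<close> has to be made explicit.\<close>
  have [measurable]: "(\<lambda>x. x) \<in> measurable (measure_pmf p) borel" for p :: "complex pmf"
    by simp
  have [measurable]: "fst \<in> borel_measurable (measure_pmf p \<Otimes>\<^sub>M uniform_measure lborel {0..1::real})"
    using measurable_compose[OF measurable_fst, of "\<lambda>x. x" "measure_pmf p" borel "uniform_measure lborel {0..1::real}"] by simp
  show ?thesis
    unfolding case_prod_beta by measurable
qed

lemma nn_integral_star_equilibrium:
  assumes m: "m > 0" and [measurable]: "f \<in> borel_measurable borel"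
  shows "(\<integral>\<^sup>+z. f z \<partial>star_equilibrium m) =
    (\<integral>\<^sup>+t. (\<Sum>u\<in>{u. u ^ m = 1}. f (u * signed_root m (2 * cos (2 * pi * t)))) / of_nat m * indicator {0..1} t \<partial>lborel)"
proof -
  define U where "U = {u::complex. u ^ m = 1}"
  have U: "finite U" "card U = m" "U \<noteq> {}"
    using m by (auto simp: U_def card_roots_unity_eq finite_roots_unity intro: exI[of _ 1])
  interpret uniform: prob_space "uniform_measure lborel {0..1::real}"
    by (rule prob_space_uniform_unit)
  interpret pair_prob_space "measure_pmf (pmf_of_set U)" "uniform_measure lborel {0..1::real}" ..
  have "(\<integral>\<^sup>+z. f z \<partial>star_equilibrium m) =
     (\<integral>\<^sup>+x. f (case x of (u, t) \<Rightarrow> u * signed_root m (2 * cos (2 * pi * t))) \<partial>(measure_pmf (pmf_of_set U) \<Otimes>\<^sub>M uniform_measure lborel {0..1}))"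
    unfolding star_equilibrium_def U_def by (intro nn_integral_distr) measurable
  also have "\<dots> = (\<integral>\<^sup>+t. \<integral>\<^sup>+u. f (u * signed_root m (2 * cos (2 * pi * t))) \<partial>measure_pmf (pmf_of_set U) \<partial>uniform_measure lborel {0..1})"
    by (subst nn_integral_snd[symmetric]) (simp_all add: case_prod_beta')
  also have "\<dots> = (\<integral>\<^sup>+t. (\<Sum>u\<in>U. f (u * signed_root m (2 * cos (2 * pi * t)))) / of_nat m \<partial>uniform_measure lborel {0..1})"
    using U by (simp add: nn_integral_pmf_of_set)
  also have "\<dots> = (\<integral>\<^sup>+t. (\<Sum>u\<in>U. f (u * signed_root m (2 * cos (2 * pi * t)))) / of_nat m * indicator {0..1} t \<partial>lborel)"
    by (subst nn_integral_uniform_measure) (auto simp: divide_ennreal_def)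
  finally show ?thesis
    by (simp add: U_def)
qed

lemma star_param_mem:
  assumes "m > 0" "u ^ m = 1"
  shows "u * signed_root m (2 * cos t) \<in> star_set m"
  unfolding mem_star_set_iff using assms
  by (intro bexI[of _ "2 * cos t"]) (auto simp: power_mult_distrib signed_root_power)

lemma star_equilibrium_in_prob_measures_on:
  assumes m: "m > 0"
  shows "star_equilibrium m \<in> prob_measures_on (star_set m)"
proof -
  interpret uniform: prob_space "uniform_measure lborel {0..1::real}"
    by (rule prob_space_uniform_unit)
  interpret pair_prob_space "measure_pmf (pmf_of_set {u::complex. u ^ m = 1})" "uniform_measure lborel {0..1::real}" ..
  have "prob_space (star_equilibrium m)"
    unfolding star_equilibrium_def by (intro prob_space_distr) measurable
  moreover have sets: "sets (star_equilibrium m) = sets borel"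
    by (simp add: star_equilibrium_def)
  moreover have "emeasure (star_equilibrium m) (- star_set m) = 0"
  proof -
    have [measurable]: "star_set m \<in> sets borel"
      using compact_star_set[OF m] by (intro borel_closed compact_imp_closed)
    have "emeasure (star_equilibrium m) (- star_set m) = (\<integral>\<^sup>+z. indicator (- star_set m) z \<partial>star_equilibrium m)"
      using sets by (intro nn_integral_indicator[symmetric]) simp
    also have "\<dots> = (\<integral>\<^sup>+t. 0 \<partial>lborel)"
      using star_param_mem[OF m]
      by (subst nn_integral_star_equilibrium[OF m]) (auto intro!: nn_integral_cong)
    finally show ?thesis
      by simp
  qed
  ultimately show ?thesis
    by (simp add: prob_measures_on_def)
qed

text \<open>The logarithm of the factorisation of \<open>z ^ m - w ^ m\<close>. Each of the
  \<open>m\<close> summands brings its own shift, which adds up to \<open>m * C\<close>; the bound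
  \<open>cmod (z - u * w) \<le> 4\<close> makes each one nonnegative.\<close>

lemma sum_shifted_kernel_roots:
  assumes m: "m > 0" and z: "cmod z \<le> 2" "cmod w \<le> 2" and C: "C \<ge> ln 4"
  shows "(\<Sum>u\<in>{u. u ^ m = 1}. shifted_kernel C z (u * w)) = shifted_kernel (real m * C) (z ^ m) (w ^ m)"
proof -
  define U where "U = {u::complex. u ^ m = 1}"
  have U: "finite U" "card U = m"
    using m by (auto simp: U_def card_roots_unity_eq finite_roots_unity)
  have prod: "(\<Prod>u\<in>U. z - u * w) = z ^ m - w ^ m"
    unfolding U_def by (rule prod_diff_roots_unity[OF m])
  show ?thesis
  proof (cases "z ^ m = w ^ m")
    case True
    \<comment> \<open>A vanishing product has a vanishing factor, so one infinite summand matches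
      the infinite diagonal value on the right.\<close>
    with prod U obtain u where u: "u \<in> U" "z = u * w"
      by auto
    have "shifted_kernel C z (u * w) \<le> (\<Sum>u\<in>U. shifted_kernel C z (u * w))"
      using U u by (intro member_le_sum) auto
    with u True show ?thesis
      by (simp add: shifted_kernel_refl top_unique U_def)
  next
    case False
    then have neq: "z \<noteq> u * w" if "u \<in> U" for u
      using that by (auto simp: U_def power_mult_distrib)
    have nonneg: "C - ln (cmod (z - u * w)) \<ge> 0" if "u \<in> U" for u
    proof -
      have "cmod u = 1"
        using that m norm_power[of u m] power_eq_1_iff[of "cmod u" m] by (auto simp: U_def)
      then have "cmod (z - u * w) \<le> 4"
        using norm_triangle_ineq4[of z "u * w"] z by (simp add: norm_mult)
      then have "ln (cmod (z - u * w)) \<le> ln 4"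
        using neq[OF that] by (intro ln_mono) auto
      with C show ?thesis
        by simp
    qed
    have "(\<Sum>u\<in>U. shifted_kernel C z (u * w)) = (\<Sum>u\<in>U. ennreal (C - ln (cmod (z - u * w))))"
      using neq by (intro sum.cong refl shifted_kernel_neq) auto
    also have "\<dots> = ennreal (\<Sum>u\<in>U. C - ln (cmod (z - u * w)))"
      using nonneg by (intro sum_ennreal)
    also have "(\<Sum>u\<in>U. C - ln (cmod (z - u * w))) = real m * C - ln (\<Prod>u\<in>U. cmod (z - u * w))"
      using U neq by (subst ln_prod) (auto simp: sum_subtractf)
    also have "(\<Prod>u\<in>U. cmod (z - u * w)) = cmod (z ^ m - w ^ m)"
      by (simp add: prod_norm prod)
    finally show ?thesis
      using False by (simp add: shifted_kernel_neq U_def)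
  qed
qed

text \<open>Averaging over the roots of unity reduces the potential at \<open>z\<close> to
  \<open>1 / m\<close> times that of the arcsine law at \<open>z ^ m\<close>, with shift
  \<open>m * C\<close>. It is therefore at most \<open>C\<close> on the star; integrating and
  removing the shift leaves at most 0.\<close>

lemma log_energy_star_equilibrium_le:
  assumes m: "m > 0"
  shows "log_energy (star_equilibrium m) \<le> 0"
proof -
  define \<nu> where "\<nu> = star_equilibrium m"
  define C where "C = ln (4::real)"
  define S where "S = (\<integral>\<^sup>+z. \<integral>\<^sup>+w. shifted_kernel C z w \<partial>\<nu> \<partial>\<nu>)"
  have \<nu>: "\<nu> \<in> prob_measures_on (star_set m)"
    unfolding \<nu>_def by (rule star_equilibrium_in_prob_measures_on[OF m])
  interpret prob_space \<nu>
    using \<nu> by (simp add: prob_measures_on_def)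
  have borel: "star_set m \<in> sets borel"
    using compact_star_set[OF m] by (intro borel_closed compact_imp_closed)
  have norm: "cmod z \<le> 2" if "z \<in> star_set m" for z
    using star_set_norm_power_le'[OF that, of 1] m by simp
  have potential: "(\<integral>\<^sup>+w. shifted_kernel C z w \<partial>\<nu>) \<le> ennreal C" if z: "z \<in> star_set m" for z
  proof -
    obtain x where x: "x \<in> {-2..2}" "z ^ m = of_real x"
      using z by (auto simp: mem_star_set_iff)
    obtain s where s: "x = 2 * cos s"
      using x(1) by (rule two_cos_cases)
    have "(\<integral>\<^sup>+w. shifted_kernel C z w \<partial>\<nu>) =
       (\<integral>\<^sup>+t. shifted_kernel (real m * C) (of_real (2 * cos s)) (of_real (2 * cos (2 * pi * t))) / of_nat m * indicator {0..1} t \<partial>lborel)"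
      unfolding \<nu>_def
    proof (subst nn_integral_star_equilibrium[OF m], measurable, rule nn_integral_cong)
      fix t :: real
      have "cmod (signed_root m (2 * cos (2 * pi * t))) \<le> 2"
        using norm star_param_mem[OF m, of 1] by simp
      then show "(\<Sum>u | u ^ m = 1. shifted_kernel C z (u * signed_root m (2 * cos (2 * pi * t)))) / of_nat m * indicator {0..1} t =
        shifted_kernel (real m * C) (of_real (2 * cos s)) (of_real (2 * cos (2 * pi * t))) / of_nat m * indicator {0..1} t"
        using norm[OF z] m x s by (subst sum_shifted_kernel_roots) (auto simp: C_def signed_root_power)
    qed
    also have "\<dots> = (\<integral>\<^sup>+t. shifted_kernel (real m * C) (of_real (2 * cos s)) (of_real (2 * cos (2 * pi * t))) * indicator {0..1} t / of_nat m \<partial>lborel)"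
      by (intro nn_integral_cong) (auto simp: indicator_def)
    also have "\<dots> = (\<integral>\<^sup>+t. shifted_kernel (real m * C) (of_real (2 * cos s)) (of_real (2 * cos (2 * pi * t))) * indicator {0..1} t \<partial>lborel) / of_nat m"
      by (intro nn_integral_divide) measurable
    also have "\<dots> \<le> ennreal (real m * C) / of_nat m"
      using m by (intro divide_right_mono_ennreal arcsine_potential_le) (auto simp: C_def mult_le_cancel_right1)
    also have "\<dots> = ennreal C"
    proof -
      have "ennreal (real m * C) / ennreal (real m) = ennreal (real m * C / real m)"
        using m by (intro divide_ennreal) (auto simp: C_def)
      then show ?thesis
        using m by (simp add: ennreal_of_nat_eq_real_of_nat)
    qed
    finally show ?thesis .
  qed
  have AE_E: "AE z in \<nu>. z \<in> star_set m"
  proof (rule AE_I)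
    show "{z \<in> space \<nu>. z \<notin> star_set m} \<subseteq> - star_set m"
      by auto
    show "emeasure \<nu> (- star_set m) = 0" "- star_set m \<in> sets \<nu>"
      using \<nu> borel by (auto simp: prob_measures_on_def)
  qed
  have "S \<le> (\<integral>\<^sup>+z. ennreal C \<partial>\<nu>)"
    unfolding S_def using AE_E by (intro nn_integral_mono_AE, eventually_elim) (rule potential)
  then have "S \<le> ennreal C"
    by (simp add: emeasure_space_1)
  then have "enn2ereal S \<le> enn2ereal (ennreal C)"
    by (simp add: less_eq_ennreal.rep_eq)
  then have "enn2ereal S \<le> ereal C"
    by (simp add: enn2ereal_ennreal C_def)
  then have "enn2ereal S - ereal C \<le> 0"
    by (simp add: ereal_minus_le_iff)
  moreover have "log_energy \<nu> = enn2ereal S - ereal C"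
    unfolding S_def
  proof (rule log_energy_eq_shifted[OF \<nu> borel])
    show "cmod (z - w) \<le> exp C" if "z \<in> star_set m" "w \<in> star_set m" for z w
      using norm_triangle_ineq4[of z w] norm[OF that(1)] norm[OF that(2)] by (simp add: C_def)
  qed (simp add: C_def)
  ultimately show ?thesis
    by (simp add: \<nu>_def)
qed

section \<open>Monic polynomials adapted to the rotations of the star\<close>

definition star_lift :: "nat \<Rightarrow> nat \<Rightarrow> real poly \<Rightarrow> complex poly" where
  "star_lift m l Q = monom 1 l * pcompose (map_poly of_real Q) (monom 1 m)"

lemma star_lift_monic:
  assumes "m > 0" "degree Q = n" "coeff Q n = 1"
  shows "degree (star_lift m l Q) = m * n + l" "lead_coeff (star_lift m l Q) = 1"
proof -
  have Q: "degree (map_poly complex_of_real Q) = n" "lead_coeff (map_poly complex_of_real Q) = 1"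
    using assms by (simp_all add: degree_map_poly coeff_map_poly)
  then have "map_poly complex_of_real Q \<noteq> 0"
    by auto
  have "lead_coeff (pcompose (map_poly complex_of_real Q) (monom 1 m)) = 1"
    using assms Q by (subst lead_coeff_comp) (auto simp: degree_monom_eq)
  moreover have "degree (pcompose (map_poly complex_of_real Q) (monom 1 m)) = m * n"
    using Q by (simp add: degree_pcompose degree_monom_eq)
  moreover from calculation have "pcompose (map_poly complex_of_real Q) (monom 1 m) \<noteq> 0"
    by auto
  ultimately show "degree (star_lift m l Q) = m * n + l" "lead_coeff (star_lift m l Q) = 1"
    unfolding star_lift_def lead_coeff_mult
    by (simp_all add: degree_mult_eq degree_monom_eq monom_eq_0_iff)
qed

lemma cmod_poly_star_lift:
  assumes "z ^ m = of_real x"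
  shows "cmod (poly (star_lift m l Q) z) = cmod z ^ l * \<bar>poly Q x\<bar>"
proof -
  have "poly (map_poly of_real Q) (complex_of_real x) = of_real (poly Q x)"
    by (simp add: poly_altdef coeff_map_poly degree_map_poly)
  with assms show ?thesis
    by (simp add: star_lift_def poly_pcompose poly_monom norm_mult norm_power)
qed

text \<open>With \<open>d = m * n + l\<close> and \<open>l < m\<close>, a Dickson polynomial in
  \<open>z ^ m\<close> times \<open>z ^ l\<close> is monic of degree \<open>d\<close>; both factors
  are at most 2 on the star. These polynomials feed the discriminant bound.\<close>

lemma bounded_monic_on_star_set:
  assumes m: "m > 0"
  shows "\<exists>p. degree p = d \<and> lead_coeff p = 1 \<and> (\<forall>z\<in>star_set m. cmod (poly p z) \<le> 4)"
proof -
  define n where "n = d div m"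
  \<comment> \<open>Degree 0 is separate because \<open>dickson_poly 0\<close> is the constant
    2.\<close>
  define Q where "Q = (if n = 0 then 1 else dickson_poly n)"
  have Q: "degree Q = n" "coeff Q n = 1"
    using degree_dickson_poly_le[of n] coeff_dickson_poly[of n] le_degree[of "dickson_poly n" n]
    by (auto simp: Q_def)
  have Q_le: "\<bar>poly Q x\<bar> \<le> 2" if x: "x \<in> {-2..2}" for x
  proof -
    obtain t where "x = 2 * cos t"
      using x by (rule two_cos_cases)
    then show ?thesis
      by (auto simp: Q_def poly_dickson_poly abs_mult)
  qed
  have "cmod (poly (star_lift m (d mod m) Q) z) \<le> 4" if z: "z \<in> star_set m" for z
  proof -
    obtain x where x: "x \<in> {-2..2}" "z ^ m = of_real x"
      using z by (auto simp: mem_star_set_iff)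
    have "cmod z ^ (d mod m) * \<bar>poly Q x\<bar> \<le> 2 * 2"
      using star_set_norm_power_le'[OF z, of "d mod m"] Q_le[OF x(1)] m
      by (intro mult_mono) auto
    then show ?thesis
      by (simp add: cmod_poly_star_lift[OF x(2)])
  qed
  then show ?thesis
    using star_lift_monic[OF m Q, of "d mod m"]
    by (intro exI[of _ "star_lift m (d mod m) Q"]) (auto simp: n_def)
qed

lemma log_capacity_star_set:
  assumes m: "m > 0"
  shows "log_capacity (star_set m) = 1"
proof -
  have "robin_constant (star_set m) \<le> log_energy (star_equilibrium m)"
    unfolding robin_constant_def by (intro INF_lower star_equilibrium_in_prob_measures_on m)
  also have "\<dots> \<le> 0"
    by (rule log_energy_star_equilibrium_le[OF m])
  finally have "robin_constant (star_set m) \<le> 0" .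
  moreover have "robin_constant (star_set m) \<ge> 0"
    unfolding robin_constant_def
  proof (rule INF_greatest)
    fix \<mu> assume "\<mu> \<in> prob_measures_on (star_set m)"
    with compact_star_set[OF m] bounded_monic_on_star_set[OF m] show "0 \<le> log_energy \<mu>"
      by (intro log_energy_nonneg[of "star_set m" 4])
         (auto intro: borel_closed compact_imp_closed compact_imp_bounded)
  qed
  ultimately have "robin_constant (star_set m) = 0"
    by (rule antisym)
  then show ?thesis
    by (simp add: log_capacity_def)
qed

section \<open>Widom factors of the star-shaped sets\<close>

lemma sum_power_roots_unity:
  assumes m: "m > 0"
  shows "(\<Sum>u\<in>{u::complex. u ^ m = 1}. u ^ k) = (if m dvd k then of_nat m else 0)"
proof (cases "m dvd k")
  case True
  then obtain j where "k = m * j"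
    by auto
  then have "(\<Sum>u\<in>{u::complex. u ^ m = 1}. u ^ k) = (\<Sum>u\<in>{u::complex. u ^ m = 1}. 1)"
    by (intro sum.cong) (auto simp: power_mult)
  with True m show ?thesis
    by (simp add: card_roots_unity_eq)
next
  case False
  define w where "w = cis (2 * pi * real k / real m)"
  have "w \<noteq> 1"
  proof
    assume "w = 1"
    then obtain i :: int where "2 * pi * real k / real m = 2 * pi * of_int i"
      by (auto simp: w_def complex_eq_iff cos_one_2pi_int)
    with m have "real k = real m * of_int i"
      by (simp add: field_simps)
    then have "real_of_int (int k) = real_of_int (int m * i)"
      by simp
    then have "int k = int m * i"
      by (simp only: of_int_eq_iff)
    then have "int m dvd int k"
      by simp
    with False show False
      by simp
  qed
  have "(\<Sum>u\<in>{u::complex. u ^ m = 1}. u ^ k) = (\<Sum>j<m. cis (2 * pi * real j / real m) ^ k)"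
    by (rule sum.reindex_bij_betw[symmetric, OF Complex.bij_betw_roots_unity[OF m]])
  also have "\<dots> = (\<Sum>j<m. w ^ j)"
    by (intro sum.cong refl) (simp add: w_def Complex.DeMoivre mult_ac)
  also have "\<dots> = (w ^ m - 1) / (w - 1)"
    using \<open>w \<noteq> 1\<close> by (rule geometric_sum)
  also have "w ^ m = cis (2 * pi * real k)"
    using m by (simp add: w_def Complex.DeMoivre)
  also have "\<dots> = 1"
    using cis_multiple_2pi[of "real k"] by simp
  finally show ?thesis
    using False by simp
qed

text \<open>Orthogonality of the characters of the group of roots of unity selects the exponents
  congruent to \<open>l\<close> modulo \<open>m\<close>. The factor \<open>u ^ (m - l)\<close>
  stands for the inverse power of order \<open>l\<close>.\<close>

lemma star_rotation_average:
  fixes P :: "complex poly"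
  assumes m: "l < m" and P: "degree P = m * n + l"
  shows "(\<Sum>u\<in>{u. u ^ m = 1}. u ^ (m - l) * poly P (u * z)) =
           of_nat m * (z ^ l * (\<Sum>j\<le>n. coeff P (m * j + l) * (z ^ m) ^ j))"
proof -
  have m0: "m > 0"
    using m by simp
  have dvd: "m dvd (m - l + i) \<longleftrightarrow> i mod m = l" for i
  proof -
    have "int (m - l + i) = int m + (int i - int l)"
      using m by simp
    then have "m dvd (m - l + i) \<longleftrightarrow> int m dvd int m + (int i - int l)"
      by (metis int_dvd_int_iff)
    also have "\<dots> \<longleftrightarrow> int m dvd int i - int l"
      by simp
    also have "\<dots> \<longleftrightarrow> int i mod int m = int l mod int m"
      by (simp add: mod_eq_dvd_iff)
    also have "\<dots> \<longleftrightarrow> i mod m = l"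
      using m by (simp flip: of_nat_mod)
    finally show ?thesis .
  qed
  have "(\<Sum>u\<in>{u. u ^ m = 1}. u ^ (m - l) * poly P (u * z)) =
          (\<Sum>u\<in>{u. u ^ m = 1}. \<Sum>i\<le>m * n + l. (coeff P i * z ^ i) * u ^ (m - l + i))"
    by (simp add: poly_altdef P sum_distrib_left power_mult_distrib power_add mult_ac)
  also have "\<dots> = (\<Sum>i\<le>m * n + l. (coeff P i * z ^ i) * (\<Sum>u\<in>{u. u ^ m = 1}. u ^ (m - l + i)))"
    by (subst sum.swap) (simp add: sum_distrib_left)
  also have "\<dots> = (\<Sum>i\<le>m * n + l. if i mod m = l then of_nat m * (coeff P i * z ^ i) else 0)"
    unfolding sum_power_roots_unity[OF m0] dvd by (intro sum.cong) auto
  also have "\<dots> = (\<Sum>i\<in>{i. i \<le> m * n + l \<and> i mod m = l}. of_nat m * (coeff P i * z ^ i))"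
    by (rule sum.mono_neutral_cong_right) auto
  also have "\<dots> = (\<Sum>j\<le>n. of_nat m * (coeff P (m * j + l) * z ^ (m * j + l)))"
  proof (rule sum.reindex_bij_witness[of _ "\<lambda>j. m * j + l" "\<lambda>i. i div m"])
    fix i assume i: "i \<in> {i. i \<le> m * n + l \<and> i mod m = l}"
    then show *: "m * (i div m) + l = i"
      using mult_div_mod_eq[of m i] by simp
    from i have "m * (i div m) + l \<le> m * n + l"
      unfolding * by simp
    then show "i div m \<in> {..n}"
      using m0 by simp
    show "of_nat m * (coeff P (m * (i div m) + l) * z ^ (m * (i div m) + l)) = of_nat m * (coeff P i * z ^ i)"
      unfolding * ..
  qed (use m in auto)
  also have "\<dots> = of_nat m * (z ^ l * (\<Sum>j\<le>n. coeff P (m * j + l) * (z ^ m) ^ j))"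
    unfolding power_add power_mult sum_distrib_left by (intro sum.cong) (simp_all only: mult_ac)
  finally show ?thesis .
qed

section \<open>Norms of the Chebyshev polynomials of the star\<close>

abbreviation star_norm :: "nat \<Rightarrow> nat \<Rightarrow> real" where
  "star_norm m k \<equiv> sup_norm_on (star_set m) (chebyshev_poly (star_set m) k)"

lemma widom_factor_star_set: "m > 0 \<Longrightarrow> widom_factor k (star_set m) = star_norm m k"
  by (simp add: widom_factor_def log_capacity_star_set)

lemma star_norm_le:
  assumes m: "m > 0" and Q: "degree Q = n" "coeff Q n = 1"
    and le: "\<And>z x. x \<in> {-2..2} \<Longrightarrow> z ^ m = of_real x \<Longrightarrow> cmod z ^ l * \<bar>poly Q x\<bar> \<le> B"
  shows "star_norm m (m * n + l) \<le> B"
proof -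
  have "star_norm m (m * n + l) \<le> sup_norm_on (star_set m) (star_lift m l Q)"
    using chebyshev_poly_is_chebyshev[OF compact_star_set[OF m] infinite_star_set] star_lift_monic[OF m Q]
    unfolding is_chebyshev_poly_def by blast
  also have "\<dots> \<le> B"
  proof (rule sup_norm_on_le)
    show "star_set m \<noteq> {}"
      using infinite_star_set[of m] by auto
    fix z assume "z \<in> star_set m"
    then obtain x where "x \<in> {-2..2}" "z ^ m = of_real x"
      by (auto simp: mem_star_set_iff)
    then show "cmod (poly (star_lift m l Q) z) \<le> B"
      using le by (simp add: cmod_poly_star_lift)
  qed
  finally show ?thesis .
qed

text \<open>
  Averaging over the rotations of \<open>star_set m\<close> keeps only the powers congruent to \<open>l\<close>
  modulo \<open>m\<close>; taking real parts of the remaining coefficients then yields a real polynomial.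
\<close>

lemma star_norm_reduction:
  assumes l: "l < m"
  obtains Q :: "real poly" where "degree Q = n" "coeff Q n = 1"
    "\<And>z x. x \<in> {-2..2} \<Longrightarrow> z ^ m = of_real x \<Longrightarrow> cmod z ^ l * \<bar>poly Q x\<bar> \<le> star_norm m (m * n + l)"
proof -
  have m: "m > 0"
    using l by simp
  define P where "P = chebyshev_poly (star_set m) (m * n + l)"
  have P: "degree P = m * n + l" "coeff P (m * n + l) = 1"
    using chebyshev_poly_is_chebyshev[OF compact_star_set[OF m] infinite_star_set, of "m * n + l"]
    by (auto simp: is_chebyshev_poly_def P_def)
  define Q where "Q = (\<Sum>j\<le>n. monom (Re (coeff P (m * j + l))) j)"
  have coeff: "coeff Q j = (if j \<le> n then Re (coeff P (m * j + l)) else 0)" for j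
    by (simp add: Q_def coeff_sum if_distrib cong: if_cong)
  have one: "coeff Q n = 1"
    using P by (simp add: coeff)
  have "degree Q \<le> n"
    by (rule degree_le) (auto simp: coeff)
  with one have "degree Q = n"
    by (simp add: le_antisym le_degree)
  moreover have "cmod z ^ l * \<bar>poly Q x\<bar> \<le> star_norm m (m * n + l)"
    if x: "x \<in> {-2..2}" "z ^ m = of_real x" for z x
  proof -
    define c where "c = (\<Sum>j\<le>n. coeff P (m * j + l) * (z ^ m) ^ j)"
    \<comment> \<open>Since \<open>z ^ m\<close> is the real number \<open>x\<close>, taking the
      real part acts on the coefficients alone.\<close>
    have "Re c = (\<Sum>j\<le>n. Re (coeff P (m * j + l) * of_real (x ^ j)))"
      by (simp add: c_def x)
    then have "poly Q x = Re c"
      by (simp add: Q_def poly_sum poly_monom)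
    then have "cmod z ^ l * \<bar>poly Q x\<bar> \<le> cmod z ^ l * cmod c"
      using abs_Re_le_cmod[of c] by (simp add: mult_left_mono)
    then have "real m * (cmod z ^ l * \<bar>poly Q x\<bar>) \<le> cmod (of_nat m * (z ^ l * c))"
      using m by (simp add: norm_mult norm_power mult_left_mono)
    also have "\<dots> = cmod (\<Sum>u\<in>{u. u ^ m = 1}. u ^ (m - l) * poly P (u * z))"
      unfolding star_rotation_average[OF l P(1)] c_def ..
    also have "\<dots> \<le> (\<Sum>u\<in>{u::complex. u ^ m = 1}. star_norm m (m * n + l))"
    proof (rule sum_norm_le)
      fix u :: complex assume u: "u \<in> {u. u ^ m = 1}"
      then have "cmod u = 1"
        using m norm_power[of u m] power_eq_1_iff[of "cmod u" m] by auto
      moreover have "u * z \<in> star_set m"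
        using u x by (auto simp: mem_star_set_iff power_mult_distrib)
      then have "cmod (poly P (u * z)) \<le> star_norm m (m * n + l)"
        unfolding P_def by (intro cmod_poly_le_sup_norm_on compact_star_set m)
      ultimately show "cmod (u ^ (m - l) * poly P (u * z)) \<le> star_norm m (m * n + l)"
        by (simp add: norm_mult norm_power)
    qed
    also have "\<dots> = real m * star_norm m (m * n + l)"
      using m by (simp add: card_roots_unity_eq)
    finally show ?thesis
      using m by simp
  qed
  ultimately show ?thesis
    using that one by blast
qed

text \<open>The residue \<open>l = 0\<close> gives the unweighted problem on \<open>[-2, 2]\<close>.
  Dickson polynomials attain 2, and the Bernstein-Szego bound with constant \<open>q = 1\<close>
  shows that no monic polynomial does better.\<close>

lemma star_norm_multiple:
  assumes m: "m > 0" and n: "n > 0"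
  shows "star_norm m (m * n) = 2"
proof (rule antisym)
  have deg: "degree (dickson_poly n) = n"
    using degree_dickson_poly_le[of n] coeff_dickson_poly[OF n] le_degree[of "dickson_poly n" n]
    by auto
  have "star_norm m (m * n + 0) \<le> 2"
  proof (rule star_norm_le[OF m deg coeff_dickson_poly[OF n]])
    fix z x assume "x \<in> {-2..2::real}"
    then obtain t where "x = 2 * cos t"
      by (rule two_cos_cases)
    then show "cmod z ^ 0 * \<bar>poly (dickson_poly n) x\<bar> \<le> 2"
      by (simp add: poly_dickson_poly abs_mult)
  qed
  then show "star_norm m (m * n) \<le> 2"
    by simp
next
  obtain Q :: "real poly" where Q: "degree Q = n" "coeff Q n = 1"
    "\<And>z x. x \<in> {-2..2} \<Longrightarrow> z ^ m = of_real x \<Longrightarrow> cmod z ^ 0 * \<bar>poly Q x\<bar> \<le> star_norm m (m * n + 0)"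
    using star_norm_reduction[OF m] by blast
  show "2 \<le> star_norm m (m * n)"
  proof (rule bernstein_szego_lower_bound[of 1 n])
    show "\<bar>poly Q (2 * cos t)\<bar> \<le> star_norm m (m * n) * cmod (poly (map_poly of_real 1) (cis (2 * t)))" for t
      using Q(3)[of "2 * cos t" "signed_root m (2 * cos t)"] signed_root_power[OF m] by simp
  qed (use n Q in auto)
qed

text \<open>On the star \<open>cmod z ^ l\<close> is \<open>\<bar>x\<bar> powr (l / m)\<close> for
  \<open>x = z ^ m\<close>, so a fixed residue is a weighted problem on \<open>[-2, 2]\<close> with
  a fixed exponent below 1.\<close>

lemma star_norm_residue_limit:
  assumes l: "l < m"
  shows "(\<lambda>n. star_norm m (m * n + l)) \<longlonglongrightarrow> 2"
\<comment> \<open>For \<open>l = 0\<close> the weight identity fails at the origin, as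
  \<open>0 powr 0 = 0\<close> but \<open>0 ^ 0 = 1\<close>; there the exact value is
  available.\<close>
proof (cases "l = 0")
  case True
  have "\<forall>\<^sub>F n in sequentially. star_norm m (m * n + l) = 2"
    using eventually_gt_at_top[of 0] by eventually_elim (use True l star_norm_multiple in simp)
  then show ?thesis
    by (rule tendsto_eventually)
next
  case False
  have m: "m > 0"
    using l by simp
  define \<gamma> where "\<gamma> = real l / real m"
  have \<gamma>: "0 < \<gamma>" "\<gamma> < 1"
    using False l by (auto simp: \<gamma>_def)
  have weight: "cmod z ^ l = \<bar>x\<bar> powr \<gamma>" if "z ^ m = of_real x" for z :: complex and x
  proof (cases "x = 0")
    case True
    with that False \<gamma> m show ?thesis
      by simp
  next
    case x: False
    then have "z \<noteq> 0"
      using that m by (metis of_real_eq_0_iff zero_power)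
    then have z: "cmod z > 0"
      by simp
    have "\<bar>x\<bar> = cmod z ^ m"
      using that by (metis norm_of_real norm_power)
    then have "\<bar>x\<bar> powr \<gamma> = (cmod z powr real m) powr \<gamma>"
      using z by (simp add: powr_realpow)
    also have "\<dots> = cmod z powr real l"
      using m by (simp add: powr_powr \<gamma>_def)
    finally show ?thesis
      using z by (simp add: powr_realpow)
  qed
  show ?thesis
  proof (rule tendstoI)
    fix e :: real assume e: "e > 0"
    have \<gamma>e: "0 \<le> \<gamma>" "\<gamma> \<le> 1" "0 < e / 2"
      using \<gamma> e by auto
    have "\<forall>\<^sub>F n in sequentially. star_norm m (m * n + l) \<le> 2 + e / 2"
      using weighted_monic_upper_bound[OF \<gamma>e]
    proof eventually_elim
      case (elim n)
      then obtain Q :: "real poly" where Q: "degree Q = n" "coeff Q n = 1"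
        "\<And>x. x \<in> {-2..2} \<Longrightarrow> \<bar>x\<bar> powr \<gamma> * \<bar>poly Q x\<bar> \<le> 2 + e / 2"
        by auto
      show ?case
        by (rule star_norm_le[OF m Q(1,2)]) (use Q(3) weight in simp)
    qed
    moreover have "\<forall>\<^sub>F n in sequentially. 2 - e / 2 \<le> star_norm m (m * n + l)"
      using weighted_monic_lower_bound[OF \<gamma>e(1) \<gamma>(2) \<gamma>e(3)]
    proof eventually_elim
      case (elim n)
      obtain Q :: "real poly" where Q: "degree Q = n" "coeff Q n = 1"
        "\<And>z x. x \<in> {-2..2} \<Longrightarrow> z ^ m = of_real x \<Longrightarrow> cmod z ^ l * \<bar>poly Q x\<bar> \<le> star_norm m (m * n + l)"
        using star_norm_reduction[OF l] by blast
      have "\<bar>x\<bar> powr \<gamma> * \<bar>poly Q x\<bar> \<le> star_norm m (m * n + l)" if "x \<in> {-2..2}" for x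
        using Q(3)[OF that signed_root_power[OF m]] weight[OF signed_root_power[OF m]] by simp
      with elim Q(1,2) show ?case
        by auto
    qed
    ultimately show "\<forall>\<^sub>F n in sequentially. dist (star_norm m (m * n + l)) 2 < e"
      by eventually_elim (use e in \<open>auto simp: dist_real_def\<close>)
  qed
qed

text \<open>There are finitely many residues, so their eventual bounds hold jointly, and
  \<open>k div m\<close> tends to infinity with \<open>k\<close>.\<close>

lemma tendsto_if_residues_tendsto:
  fixes f :: "nat \<Rightarrow> 'a::metric_space"
  assumes m: "m > 0" and lim: "\<And>l. l < m \<Longrightarrow> (\<lambda>n. f (m * n + l)) \<longlonglongrightarrow> L"
  shows "f \<longlonglongrightarrow> L"
proof (rule tendstoI)
  fix e :: real assume "e > 0"
  then have "\<forall>\<^sub>F n in sequentially. \<forall>l\<in>{..<m}. dist (f (m * n + l)) L < e"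
    using lim by (intro eventually_ball_finite ballI) (auto dest: tendstoD)
  moreover have "filterlim (\<lambda>k. k div m) sequentially sequentially"
    using m by (rule filterlim_at_top_div_const_nat)
  ultimately have "\<forall>\<^sub>F k in sequentially. \<forall>l\<in>{..<m}. dist (f (m * (k div m) + l)) L < e"
    by (rule eventually_compose_filterlim)
  then show "\<forall>\<^sub>F k in sequentially. dist (f k) L < e"
  proof eventually_elim
    case (elim k)
    from bspec[OF elim, of "k mod m"] m show ?case
      by simp
  qed
qed

text \<open>Here \<open>n = 1\<close> and \<open>l = m - 1\<close>. The polynomial
  \<open>Q x = x\<close> gives the upper bound. For any monic linear \<open>Q\<close> the values at
  2 and -2 differ by 4, so one has modulus at least 2, and at both points the weight is
  maximal.\<close>

lemma star_norm_odd:
  assumes m: "m > 0"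
  shows "star_norm m (2 * m - 1) = root m 2 ^ (2 * m - 1)"
proof -
  have idx: "2 * m - 1 = m * 1 + (m - 1)" and l: "m - 1 < m"
    using m by auto
  have root: "root m 2 ^ (2 * m - 1) = root m 2 ^ (m - 1) * 2"
    unfolding idx power_add using m by simp
  have norm_z: "cmod z ^ m = \<bar>x\<bar>" if "z ^ m = of_real x" for z :: complex and x
    using that by (metis norm_of_real norm_power)
  have "star_norm m (m * 1 + (m - 1)) \<le> root m 2 ^ (m - 1) * 2"
  proof (rule star_norm_le[OF m])
    show "degree [:0, 1::real:] = 1" "coeff [:0, 1::real:] 1 = 1"
      by auto
    fix z :: complex and x :: real assume x: "x \<in> {-2..2}" "z ^ m = of_real x"
    have "cmod z = root m (cmod z ^ m)"
      using m by (simp add: real_root_power_cancel)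
    also have "\<dots> \<le> root m 2"
      using m x norm_z[OF x(2)] by (simp add: abs_le_iff)
    finally have "cmod z \<le> root m 2" .
    then show "cmod z ^ (m - 1) * \<bar>poly [:0, 1:] x\<bar> \<le> root m 2 ^ (m - 1) * 2"
      using x by (intro mult_mono power_mono) (auto simp: real_root_ge_zero)
  qed
  moreover have "root m 2 ^ (m - 1) * 2 \<le> star_norm m (m * 1 + (m - 1))"
  proof -
    obtain Q :: "real poly" where Q: "degree Q = 1" "coeff Q 1 = 1"
      "\<And>z x. x \<in> {-2..2} \<Longrightarrow> z ^ m = of_real x \<Longrightarrow> cmod z ^ (m - 1) * \<bar>poly Q x\<bar> \<le> star_norm m (m * 1 + (m - 1))"
      using star_norm_reduction[OF l] by blast
    have root_norm: "cmod (signed_root m x) = root m \<bar>x\<bar>" for x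
      using m by (simp add: signed_root_def norm_mult)
    have le: "root m 2 ^ (m - 1) * \<bar>poly Q x\<bar> \<le> star_norm m (m * 1 + (m - 1))" if "\<bar>x\<bar> = 2" for x
    proof -
      have "x \<in> {-2..2}"
        using that by auto
      from Q(3)[OF this signed_root_power[OF m]] show ?thesis
        unfolding root_norm that .
    qed
    have "poly Q x = coeff Q 0 + x" for x
      using Q by (simp add: poly_altdef)
    then have "\<bar>poly Q 2\<bar> + \<bar>poly Q (-2)\<bar> \<ge> 4"
      by simp
    then have "root m 2 ^ (m - 1) * 4 \<le> root m 2 ^ (m - 1) * (\<bar>poly Q 2\<bar> + \<bar>poly Q (-2)\<bar>)"
      using m by (intro mult_left_mono) auto
    with le[of 2] le[of "-2"] show ?thesis
      by (simp add: distrib_left)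
  qed
  ultimately show ?thesis
    unfolding root unfolding idx by simp
qed

theorem theorem2:
  shows "(\<forall>m::nat. m \<ge> 1 \<longrightarrow>
            (\<forall>n::nat. n \<ge> 1 \<longrightarrow> widom_factor (m * n) (star_set m) = 2) \<and>
            (\<lambda>n::nat. widom_factor n (star_set m)) \<longlonglongrightarrow> 2) \<and>
         (\<lambda>m::nat. widom_factor (2 * m - 1) (star_set m)) \<longlonglongrightarrow> 4"
proof (intro conjI allI impI)
  fix m n :: nat assume "m \<ge> 1" "n \<ge> 1"
  then show "widom_factor (m * n) (star_set m) = 2"
    by (simp add: widom_factor_star_set star_norm_multiple)
next
  fix m :: nat assume m: "m \<ge> 1"
  show "(\<lambda>n. widom_factor n (star_set m)) \<longlonglongrightarrow> 2"
  proof (rule tendsto_if_residues_tendsto[of m])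
    show "(\<lambda>n. widom_factor (m * n + l) (star_set m)) \<longlonglongrightarrow> 2" if "l < m" for l
      using star_norm_residue_limit[OF that] m by (simp add: widom_factor_star_set)
  qed (use m in simp)
next
  have "(\<lambda>m. 2 powr (2 - 1 / real m)) \<longlonglongrightarrow> 2 powr (2 - 0)"
    by (intro tendsto_intros) (real_asymp | simp)+
  then have "(\<lambda>m. 2 powr (2 - 1 / real m)) \<longlonglongrightarrow> 4"
    by simp
  \<comment> \<open>The closed form \<open>2 powr (2 - 1 / m)\<close> is established for
    \<open>m > 0\<close>, which is enough for the limit.\<close>
  moreover have "\<forall>\<^sub>F m in sequentially. 2 powr (2 - 1 / real m) = widom_factor (2 * m - 1) (star_set m)"
    using eventually_gt_at_top[of 0]
  proof eventually_elim
    case (elim m)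
    have "root m 2 ^ (2 * m - 1) = root m 2 powr real (2 * m - 1)"
      using elim by (intro powr_realpow[symmetric]) simp
    also have "\<dots> = (2 powr (1 / real m)) powr real (2 * m - 1)"
      using elim by (simp add: root_powr_inverse)
    also have "\<dots> = 2 powr (2 - 1 / real m)"
      using elim by (simp add: powr_powr of_nat_diff field_simps)
    finally show ?case
      unfolding widom_factor_star_set[OF elim] star_norm_odd[OF elim] by (rule sym)
  qed
  ultimately show "(\<lambda>m. widom_factor (2 * m - 1) (star_set m)) \<longlonglongrightarrow> 4"
    by (rule Lim_transform_eventually)
qed

end
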